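(* The functions $J_{k,N,a}$ are symmetric under the Weyl group $\mathcal W$ of the Lie algebra $A_{L-1}$: $$J_{k,N,a}(z;X)=J_{k,N,wa}(z;X)\qquad\forall w\in\mathcal W,$$ or, equivalently, $$J_{N,a}(x_1,\dots,x_N)_{k_1\dots k_N}=J_{N,wa}(x_1,\dots,x_N)_{k_1\dots k_N}\qquad\forall w\in\mathcal W,$$ for all $a\in\mathfrak h^*$, all $N$, all $k$ and all $k_1,\dots,k_N\in\{1,\dots,L-1\}$.
   Context: Fix an integer $L\ge2$ and an irrational $p\in(0,1)$; $\omega=e^{2\pi i/L}$ and $\omega^c:=e^{2\pi i c/L}$ for $c\in\mathbb C$. $\mathfrak h^*$ is the complex dual Cartan subalgebra of the Lie algebra $A_{L-1}$ with its invariant bilinear form $\langle\cdot,\cdot\rangle$ and simple roots $\alpha_1,\dots,\alpha_{L-1}$, $\langle\alpha_i,\alpha_j\rangle=2\delta_{ij}-\delta_{i,j+1}-\delta_{i,j-1}$. $H_1,\dots,H_L\in\mathfrak h^*$ are the weights of the first fundamental representation: $\langle\alpha_i,H_s\rangle=\delta_{is}-\delta_{i,s-1}$, $\sum_sH_s=0$. For $S\subseteq\{1,\dots,L\}$ put $H_S=\sum_{s\in S}H_s$. The Weyl group $\mathcal W$ is generated by the reflections $w_ia=a-\langle a,\alpha_i\rangle\alpha_i$, $i=1,\dots,L-1$. Let $$f(z)=\frac{(z-\omega^p)(z-\omega^{1-p})}{(z-1)(z-\omega)}.$$ **The functions $J_{N,a}$.** Let $N\ge0$ and let $k_1,\dots,k_N$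 be integers in $\{1,\dots,L\}$. For a tuple $\underline S=(S_1,\dots,S_N)$ of subsets of $\{1,\dots,L\}$ with $|S_n|=k_n$, $S_n=\{s^{(n)}_1<\dots<s^{(n)}_{k_n}\}$, put $y^{(n)}_j=x_n\omega^{(k_n+1-2j)/2}$, and let $\Phi_{\underline S}(x_1,\dots,x_N)$ be the product, over all $m<n$ and all pairs $(j,j')$ with $s^{(m)}_j\ne s^{(n)}_{j'}$, of the factors $f(y^{(m)}_j/y^{(n)}_{j'})$ if $s^{(m)}_j<s^{(n)}_{j'}$ and $f(y^{(n)}_{j'}/y^{(m)}_j)$ if $s^{(m)}_j>s^{(n)}_{j'}$. Define the rational functions $$J_{N,a}(x_1,\dots,x_N)_{k_1\dots k_N}=\sum_{\underline S}\omega^{\langle a,\sum_nH_{S_n}\rangle}\Phi_{\underline S}(x_1,\dots,x_N).$$ **The functions $J_{k,N,a}$.** For $1\le k\le L$, $N\ge0$ and $X=(x_1,\dots,x_N)$, $$J_{k,N+1,a}(z;X)=\prod_{n=1}^N\prod_{m=1}^{k-1}f^{-1}\Bigl(\frac z{x_n}\omega^{\frac{k+1-2m}2}\Bigr)\;J_{N+1,a}(z,x_1,\dots,x_N)_{k\,1\dots1},\qquad f^{-1}=1/f.$$ *)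

theory Defs
  imports Complex_Main "HOL-Algebra.Bij" "HOL-Algebra.Generated_Groups"
begin

section \<open>The dual Cartan subalgebra of type A and its Weyl group\<close>

text \<open>
  The dual Cartan subalgebra is realized as the trace-zero hyperplane of the L-dimensional
  complex coordinate space. Vectors are functions on the naturals that vanish outside 1,...,L, and
  the form is complex bilinear (no conjugation).
\<close>

definition hstar :: "nat \<Rightarrow> (nat \<Rightarrow> complex) set" where
  "hstar L = {a. (\<forall>i. i \<notin> {1..L} \<longrightarrow> a i = 0) \<and> (\<Sum>i=1..L. a i) = 0}"

definition form :: "nat \<Rightarrow> (nat \<Rightarrow> complex) \<Rightarrow> (nat \<Rightarrow> complex) \<Rightarrow> complex" where
  "form L a b = (\<Sum>i=1..L. a i * b i)"

definition simple_root :: "nat \<Rightarrow> nat \<Rightarrow> complex" where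
  "simple_root i = (\<lambda>j. of_bool (j = i) - of_bool (j = i + 1))"

definition fund_weight :: "nat \<Rightarrow> nat \<Rightarrow> nat \<Rightarrow> complex" where
  "fund_weight L s = (\<lambda>j. if j \<in> {1..L} then of_bool (j = s) - 1 / of_nat L else 0)"

definition set_weight :: "nat \<Rightarrow> nat set \<Rightarrow> nat \<Rightarrow> complex" where
  "set_weight L S = (\<lambda>j. \<Sum>s\<in>S. fund_weight L s j)"

definition simple_reflection :: "nat \<Rightarrow> nat \<Rightarrow> (nat \<Rightarrow> complex) \<Rightarrow> nat \<Rightarrow> complex" where
  "simple_reflection L i a = (\<lambda>j. a j - form L a (simple_root i) * simple_root i j)"

text \<open>Elements of the group of bijections of a set are functions restricted to that set.\<close>

definition weyl_group :: "nat \<Rightarrow> ((nat \<Rightarrow> complex) \<Rightarrow> nat \<Rightarrow> complex) set" where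
  "weyl_group L =
     generate (BijGroup (hstar L)) ((\<lambda>i. restrict (simple_reflection L i) (hstar L)) ` {1..L-1})"

text \<open>The data above satisfy the defining relations of the root system.\<close>

lemma sum_single:
  fixes i L :: nat
  assumes "i \<in> {1..L}"
  shows "(\<Sum>j=1..L. c j * of_bool (j = i)) = (c i :: complex)"
proof -
  have "(\<Sum>j=1..L. c j * of_bool (j = i)) = (\<Sum>j=1..L. if i = j then c j else 0)"
    by (rule sum.cong) auto
  also have "\<dots> = c i"
    using assms by (subst sum.delta') auto
  finally show ?thesis .
qed

lemma form_simple_root:
  assumes "i \<in> {1..L-1}"
  shows "form L a (simple_root i) = a i - a (i + 1)"
proof -
  from assms have "i \<in> {1..L}" "i + 1 \<in> {1..L}"
    by auto
  then show ?thesis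
    unfolding form_def simple_root_def
    by (simp add: right_diff_distrib sum_subtractf sum_single del: atLeastAtMost_iff)
qed

lemma form_commute: "form L a b = form L b a"
  by (simp add: form_def mult.commute)

lemma simple_root_in_hstar:
  assumes "i \<in> {1..L-1}"
  shows "simple_root i \<in> hstar L"
proof -
  have "(\<Sum>j=1..L. simple_root i j) = form L (\<lambda>_. 1) (simple_root i)"
    by (simp add: form_def)
  also have "\<dots> = 0"
    using assms by (simp add: form_simple_root)
  finally show ?thesis
    using assms by (auto simp: hstar_def simple_root_def)
qed

lemma form_simple_roots:
  assumes "i \<in> {1..L-1}" "j \<in> {1..L-1}"
  shows "form L (simple_root i) (simple_root j)
           = 2 * of_bool (i = j) - of_bool (i = j + 1) - of_bool (i + 1 = j)"
  using assms by (simp add: form_simple_root) (auto simp: simple_root_def)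

lemma form_root_fund_weight:
  assumes "i \<in> {1..L-1}"
  shows "form L (simple_root i) (fund_weight L s) = of_bool (i = s) - of_bool (i + 1 = s)"
  using assms
  by (subst form_commute) (auto simp: form_simple_root fund_weight_def)

lemma fund_weight_in_hstar:
  assumes "s \<in> {1..L}"
  shows "fund_weight L s \<in> hstar L"
proof -
  have "(\<Sum>j=1..L. fund_weight L s j) = (\<Sum>j=1..L. 1 * of_bool (j = s) - 1 / of_nat L)"
    by (intro sum.cong) (auto simp: fund_weight_def)
  also have "\<dots> = 0"
    using assms by (subst sum_subtractf, subst sum_single) auto
  finally show ?thesis
    by (auto simp: hstar_def fund_weight_def)
qed

lemma sum_fund_weights: "set_weight L {1..L} j = 0"
proof (cases "j \<in> {1..L}")
  case True
  then have "set_weight L {1..L} j = (\<Sum>s=1..L. 1 * of_bool (s = j) - 1 / of_nat L)"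
    unfolding set_weight_def by (intro sum.cong) (auto simp: fund_weight_def)
  also have "\<dots> = 0"
    using True by (subst sum_subtractf, subst sum_single) auto
  finally show ?thesis .
qed (auto simp: set_weight_def fund_weight_def intro!: sum.neutral)

lemma simple_reflection_in_hstar:
  assumes "i \<in> {1..L-1}" "a \<in> hstar L"
  shows "simple_reflection L i a \<in> hstar L"
  using assms simple_root_in_hstar[OF assms(1)]
  by (simp add: hstar_def simple_reflection_def sum_subtractf flip: sum_distrib_left)

lemma simple_reflection_involution:
  assumes "i \<in> {1..L-1}"
  shows "simple_reflection L i (simple_reflection L i a) = a"
proof -
  have "form L (simple_reflection L i a) (simple_root i) = - form L a (simple_root i)"
    using assms by (simp add: form_simple_root simple_reflection_def) (simp add: simple_root_def)
  then show ?thesis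
    by (simp add: simple_reflection_def[of L i "simple_reflection L i a"])
       (simp add: simple_reflection_def)
qed

lemma simple_reflection_in_BijGroup:
  assumes "i \<in> {1..L-1}"
  shows "restrict (simple_reflection L i) (hstar L) \<in> carrier (BijGroup (hstar L))"
proof -
  have "bij_betw (simple_reflection L i) (hstar L) (hstar L)"
    by (rule bij_betw_byWitness[where f' = "simple_reflection L i"])
       (use assms simple_reflection_in_hstar simple_reflection_involution in auto)
  then show ?thesis
    by (auto simp: BijGroup_def Bij_def cong: bij_betw_cong)
qed

lemma ex1_simple_root_coordinates:
  assumes "a \<in> hstar L"
  shows "\<exists>!c. (\<forall>i. i \<notin> {1..L-1} \<longrightarrow> c i = 0) \<and> a = (\<lambda>j. \<Sum>i=1..L-1. c i * simple_root i j)"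
proof -
  have expand: "(\<Sum>i=1..L-1. c i * simple_root i j) = c j - (if j = 0 then 0 else c (j - 1))"
    if c: "\<forall>i. i \<notin> {1..L-1} \<longrightarrow> c i = 0" for c :: "nat \<Rightarrow> complex" and j
  proof -
    have *: "(\<Sum>i=1..L-1. c i * of_bool (i = k)) = c k" for k
    proof (cases "k \<in> {1..L-1}")
      case True
      then show ?thesis by (rule sum_single)
    next
      case False
      then have "(\<Sum>i=1..L-1. c i * of_bool (i = k)) = 0"
        by (intro sum.neutral) auto
      with False c show ?thesis by simp
    qed
    have "(\<Sum>i=1..L-1. c i * simple_root i j)
            = (\<Sum>i=1..L-1. c i * of_bool (i = j))
              - (\<Sum>i=1..L-1. c i * of_bool (j = i + 1))"
      by (simp add: simple_root_def right_diff_distrib sum_subtractf eq_commute[of j])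
    also have "(\<Sum>i=1..L-1. c i * of_bool (j = i + 1)) = (if j = 0 then 0 else c (j - 1))"
    proof (cases j)
      case (Suc k)
      have "(\<Sum>i=1..L-1. c i * of_bool (j = i + 1)) = (\<Sum>i=1..L-1. c i * of_bool (i = k))"
        by (rule sum.cong) (auto simp: Suc)
      with *[of k] Suc show ?thesis by simp
    qed simp
    finally show ?thesis
      by (simp only: *)
  qed
  define c where "c = (\<lambda>j. \<Sum>i=1..j. a i)"
  have a0: "a i = 0" if "i \<notin> {1..L}" for i
    using assms that by (auto simp: hstar_def)
  have cL: "c L = 0"
    using assms by (simp add: hstar_def c_def)
  have c0: "c i = 0" if "i \<notin> {1..L-1}" for i
  proof (cases "i = 0")
    case False
    with that have "L \<le> i" by auto
    then have "c i = c L"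
      unfolding c_def by (intro sum.mono_neutral_right) (use a0 in auto)
    with cL show ?thesis by simp
  qed (simp add: c_def)
  have a_eq: "a j = c j - (if j = 0 then 0 else c (j - 1))" for j
    using a0[of 0] by (cases j) (auto simp: c_def)
  show ?thesis
  proof (rule ex1I[of _ c])
    show "(\<forall>i. i \<notin> {1..L-1} \<longrightarrow> c i = 0) \<and> a = (\<lambda>j. \<Sum>i=1..L-1. c i * simple_root i j)"
      using c0 a_eq expand[of c] by (metis ext)
  next
    fix d
    assume d: "(\<forall>i. i \<notin> {1..L-1} \<longrightarrow> d i = 0) \<and> a = (\<lambda>j. \<Sum>i=1..L-1. d i * simple_root i j)"
    then have a_eq': "a j = d j - (if j = 0 then 0 else d (j - 1))" for j
      using expand[of d j] by auto
    have "d j = c j" for j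
    proof (induction j)
      case 0
      then show ?case using a_eq[of 0] a_eq'[of 0] by simp
    next
      case (Suc j)
      then show ?case using a_eq[of "Suc j"] a_eq'[of "Suc j"] by simp
    qed
    then show "d = c" by auto
  qed
qed


section \<open>The functions J\<close>

definition omega_pow :: "nat \<Rightarrow> complex \<Rightarrow> complex" where
  "omega_pow L c = exp (2 * of_real pi * \<i> * c / of_nat L)"

definition f :: "nat \<Rightarrow> real \<Rightarrow> complex \<Rightarrow> complex" where
  "f L p z = (z - omega_pow L (of_real p)) * (z - omega_pow L (1 - of_real p))
               / ((z - 1) * (z - omega_pow L 1))"

definition f_poles :: "nat \<Rightarrow> complex set" where
  "f_poles L = {1, omega_pow L 1}"

definition f_zeros :: "nat \<Rightarrow> real \<Rightarrow> complex set" where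
  "f_zeros L p = {omega_pow L (of_real p), omega_pow L (1 - of_real p)}"

text \<open>
  Tuples of length N are functions on the naturals of which only the values at 1,...,N matter.
  The elements of a set are likewise numbered from 1, in increasing order.
\<close>

definition elt :: "nat set \<Rightarrow> nat \<Rightarrow> nat" where
  "elt S j = sorted_list_of_set S ! (j - 1)"

definition set_tuples :: "nat \<Rightarrow> nat \<Rightarrow> (nat \<Rightarrow> nat) \<Rightarrow> (nat \<Rightarrow> nat set) set" where
  "set_tuples L N ks = (\<Pi>\<^sub>E n\<in>{1..N}. {S. S \<subseteq> {1..L} \<and> card S = ks n})"

definition yvar :: "nat \<Rightarrow> (nat \<Rightarrow> nat) \<Rightarrow> (nat \<Rightarrow> complex) \<Rightarrow> nat \<Rightarrow> nat \<Rightarrow> complex" where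
  "yvar L ks x n j = x n * omega_pow L ((of_nat (ks n) + 1 - 2 * of_nat j) / 2)"

definition Phi ::
  "nat \<Rightarrow> real \<Rightarrow> nat \<Rightarrow> (nat \<Rightarrow> nat) \<Rightarrow> (nat \<Rightarrow> nat set) \<Rightarrow> (nat \<Rightarrow> complex) \<Rightarrow> complex" where
  "Phi L p N ks S x =
     (\<Prod>n\<in>{1..N}. \<Prod>m\<in>{1..<n}. \<Prod>j\<in>{1..ks m}. \<Prod>j'\<in>{1..ks n}.
        (if elt (S m) j < elt (S n) j' then f L p (yvar L ks x m j / yvar L ks x n j')
         else if elt (S m) j > elt (S n) j' then f L p (yvar L ks x n j' / yvar L ks x m j)
         else 1))"

definition J ::
  "nat \<Rightarrow> real \<Rightarrow> nat \<Rightarrow> (nat \<Rightarrow> complex) \<Rightarrow> (nat \<Rightarrow> complex) \<Rightarrow> (nat \<Rightarrow> nat) \<Rightarrow> complex" where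
  "J L p N a x ks =
     (\<Sum>S\<in>set_tuples L N ks.
        omega_pow L (form L a (\<lambda>i. \<Sum>n=1..N. set_weight L (S n) i)) * Phi L p N ks S x)"

text \<open>
  Rational functions are rendered by their values off the poles: since division by zero is 0 in
  HOL, identities between them are asserted at the points where every factor occurring in their
  defining expressions is finite. These points form the complement of finitely many hyperplanes.
\<close>

definition J_regular :: "nat \<Rightarrow> nat \<Rightarrow> (nat \<Rightarrow> complex) \<Rightarrow> (nat \<Rightarrow> nat) \<Rightarrow> bool" where
  "J_regular L N x ks \<longleftrightarrow>
     (\<forall>n\<in>{1..N}. x n \<noteq> 0) \<and>
     (\<forall>S\<in>set_tuples L N ks. \<forall>n\<in>{1..N}. \<forall>m\<in>{1..<n}. \<forall>j\<in>{1..ks m}. \<forall>j'\<in>{1..ks n}.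
        (elt (S m) j < elt (S n) j' \<longrightarrow> yvar L ks x m j / yvar L ks x n j' \<notin> f_poles L) \<and>
        (elt (S m) j > elt (S n) j' \<longrightarrow> yvar L ks x n j' / yvar L ks x m j \<notin> f_poles L))"

definition prepend :: "'a \<Rightarrow> (nat \<Rightarrow> 'a) \<Rightarrow> nat \<Rightarrow> 'a" where
  "prepend c g = (\<lambda>n. if n = 1 then c else g (n - 1))"

text \<open>
  In \<open>Jz L p k M a z X\<close> the number M counts z together with the M - 1 entries of X; only
  M greater than 0 is meaningful. At a pole of f the value \<open>inverse (f L p _)\<close> is 0, as it should
  be, so only the zeros of f have to be excluded for the prefactor.
\<close>

definition Jz ::
  "nat \<Rightarrow> real \<Rightarrow> nat \<Rightarrow> nat \<Rightarrow> (nat \<Rightarrow> complex) \<Rightarrow> complex \<Rightarrow> (nat \<Rightarrow> complex) \<Rightarrow> complex" where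
  "Jz L p k M a z X =
     (\<Prod>n\<in>{1..M-1}. \<Prod>m\<in>{1..k-1}.
        inverse (f L p (z / X n * omega_pow L ((of_nat k + 1 - 2 * of_nat m) / 2))))
     * J L p M a (prepend z X) (prepend k (\<lambda>_. 1))"

definition Jz_regular ::
  "nat \<Rightarrow> real \<Rightarrow> nat \<Rightarrow> nat \<Rightarrow> complex \<Rightarrow> (nat \<Rightarrow> complex) \<Rightarrow> bool" where
  "Jz_regular L p k M z X \<longleftrightarrow>
     J_regular L M (prepend z X) (prepend k (\<lambda>_. 1)) \<and>
     (\<forall>n\<in>{1..M-1}. \<forall>m\<in>{1..k-1}.
        z / X n * omega_pow L ((of_nat k + 1 - 2 * of_nat m) / 2) \<notin> f_zeros L p)"

end

theory Submission
  imports Defs "HOL-Computational_Algebra.Polynomial" "HOL-Combinatorics.Transposition"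
begin

text \<open>
  A simple reflection swaps the coordinates \<open>a\<^sub>i\<close> and \<open>a\<^sub>i\<^sub>+\<^sub>1\<close> of a. Group the tuples of subsets by
  exchanging i and i + 1 freely inside the active sets, those which contain exactly one of
  the two. Since \<open>f (\<omega> / z) = f z\<close>, all factors of \<open>\<Phi>\<close> other than those between i and i + 1 of two
  active sets are constant on a group. What remains is the symmetry in x and y of
  \<open>\<Sum>\<^bsub>A \<subseteq> I\<^esub> x\<^bsup>|A|\<^esup> y\<^bsup>|I - A|\<^esup> \<Prod>\<^bsub>m \<in> A, n \<in> I - A\<^esub> f (u\<^sub>m / u\<^sub>n)\<close>, an identity of Ruijsenaars type.

  It is proved by induction on the size of I. Multiplied by a common denominator, the sum becomes a
  polynomial of degree at most 3(|I| - 1) in one of the variables z. The difference of the two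
  sides vanishes at z = 0 and at \<open>z = u\<^sub>b, \<omega> u\<^sub>b, \<omega>\<^sup>-\<^sup>1 u\<^sub>b\<close> for every other b: at \<open>u\<^sub>b\<close> because the residues
  of each side cancel, at the other points by the induction hypothesis. These are 3(|I| - 1) + 1
  points if \<open>\<omega>\<close> and u are generic; the general case follows by continuity in \<open>\<omega>\<close> and u.
\<close>

section \<open>Sums over splittings of a finite set\<close>

definition split_sum ::
  "('i \<Rightarrow> 'i \<Rightarrow> 'a::comm_semiring_1) \<Rightarrow> 'i set \<Rightarrow> ('i \<Rightarrow> 'a) \<Rightarrow> ('i \<Rightarrow> 'a) \<Rightarrow> 'a" where
  "split_sum k I \<alpha> \<beta> =
     (\<Sum>A\<in>Pow I. prod \<alpha> A * prod \<beta> (I - A) * (\<Prod>m\<in>A. \<Prod>n\<in>I-A. k m n))"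

lemma split_sum_empty [simp]: "split_sum k {} \<alpha> \<beta> = 1"
  by (simp add: split_sum_def)

lemma split_sum_cong:
  assumes "\<And>m n. m \<in> I \<Longrightarrow> n \<in> I \<Longrightarrow> k m n = k' m n"
    and "\<And>c. c \<in> I \<Longrightarrow> \<alpha> c = \<alpha>' c" "\<And>c. c \<in> I \<Longrightarrow> \<beta> c = \<beta>' c"
  shows "split_sum k I \<alpha> \<beta> = split_sum k' I \<alpha>' \<beta>'"
  unfolding split_sum_def
  by (intro sum.cong refl arg_cong2[where f = "(*)"] prod.cong assms) auto

text \<open>Subsets containing \<open>b\<close> and subsets avoiding it are summed separately. The
  kernel factors linking \<open>b\<close> to a remaining \<open>c\<close> are absorbed into the
  weight of \<open>c\<close>, which is why weights are functions rather than constants.\<close>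

lemma split_sum_insert:
  assumes "finite I" "b \<notin> I"
  shows "split_sum k (insert b I) \<alpha> \<beta> =
     \<alpha> b * split_sum k I \<alpha> (\<lambda>c. \<beta> c * k b c) + \<beta> b * split_sum k I (\<lambda>c. \<alpha> c * k c b) \<beta>"
proof -
  let ?g = "\<lambda>A. prod \<alpha> A * prod \<beta> (insert b I - A) * (\<Prod>m\<in>A. \<Prod>n\<in>insert b I-A. k m n)"
  have fin: "finite A" "b \<notin> A" if "A \<in> Pow I" for A
    using that assms finite_subset by auto
  have "split_sum k (insert b I) \<alpha> \<beta> = sum ?g (Pow I) + sum ?g (insert b ` Pow I)"
    unfolding split_sum_def Pow_insert by (rule sum.union_disjoint) (use assms in auto)
  moreover have "sum ?g (Pow I) = \<beta> b * split_sum k I (\<lambda>c. \<alpha> c * k c b) \<beta>"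
    unfolding split_sum_def sum_distrib_left
  proof (rule sum.cong[OF refl])
    fix A assume A: "A \<in> Pow I"
    have "insert b I - A = insert b (I - A)" using fin[OF A] by auto
    then show "?g A = \<beta> b * ((\<Prod>c\<in>A. \<alpha> c * k c b) * prod \<beta> (I - A) * (\<Prod>m\<in>A. \<Prod>n\<in>I - A. k m n))"
      using assms by (simp add: prod.distrib mult_ac)
  qed
  moreover have "sum ?g (insert b ` Pow I) = \<alpha> b * split_sum k I \<alpha> (\<lambda>c. \<beta> c * k b c)"
  proof -
    have "inj_on (insert b) (Pow I)" using assms by (auto simp: inj_on_def)
    then have "sum ?g (insert b ` Pow I) = (\<Sum>A\<in>Pow I. ?g (insert b A))"
      by (simp add: sum.reindex)
    also have "\<dots> = \<alpha> b * split_sum k I \<alpha> (\<lambda>c. \<beta> c * k b c)"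
      unfolding split_sum_def sum_distrib_left
    proof (rule sum.cong[OF refl])
      fix A assume A: "A \<in> Pow I"
      have "insert b I - insert b A = I - A" using assms by auto
      then show "?g (insert b A) = \<alpha> b * (prod \<alpha> A * (\<Prod>c\<in>I - A. \<beta> c * k b c) * (\<Prod>m\<in>A. \<Prod>n\<in>I - A. k m n))"
        using fin[OF A] by (simp add: prod.distrib mult_ac)
    qed
    finally show ?thesis .
  qed
  ultimately show ?thesis by (simp add: add.commute)
qed

text \<open>Every \<open>c\<close> in \<open>I\<close> contributes \<open>\<gamma> c\<close> exactly
  once, whichever side of the splitting it lies on.\<close>

lemma split_sum_scale:
  assumes "finite I"
  shows "split_sum k I (\<lambda>c. \<alpha> c * \<gamma> c) (\<lambda>c. \<beta> c * \<gamma> c) = prod \<gamma> I * split_sum k I \<alpha> \<beta>"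
  unfolding split_sum_def sum_distrib_left
proof (rule sum.cong[OF refl])
  fix A assume "A \<in> Pow I"
  then have "prod \<gamma> I = prod \<gamma> (I - A) * prod \<gamma> A"
    using assms prod.subset_diff by blast
  then show "(\<Prod>c\<in>A. \<alpha> c * \<gamma> c) * (\<Prod>c\<in>I - A. \<beta> c * \<gamma> c) * (\<Prod>m\<in>A. \<Prod>n\<in>I - A. k m n)
      = prod \<gamma> I * (prod \<alpha> A * prod \<beta> (I - A) * (\<Prod>m\<in>A. \<Prod>n\<in>I - A. k m n))"
    by (simp add: prod.distrib mult_ac)
qed

section \<open>Splitting sums as polynomials in one variable\<close>

lemma poly_split_sum:
  "poly (split_sum (\<lambda>m n. [:k m n:]) I \<alpha> \<beta>) z =
     split_sum k I (\<lambda>c. poly (\<alpha> c) z) (\<lambda>c. poly (\<beta> c) z)"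
  by (simp add: split_sum_def poly_sum poly_prod)

lemma degree_prod_le:
  fixes g :: "'i \<Rightarrow> 'a::comm_semiring_1 poly"
  assumes "finite A" "\<And>c. c \<in> A \<Longrightarrow> degree (g c) \<le> d"
  shows "degree (prod g A) \<le> d * card A"
proof -
  have "degree (prod g A) \<le> sum (degree \<circ> g) A" by (rule degree_prod_sum_le[OF assms(1)])
  also have "\<dots> \<le> of_nat (card A) * d" by (rule sum_bounded_above) (use assms in auto)
  finally show ?thesis by (simp add: mult.commute)
qed

text \<open>The kernel enters through constants only, and every splitting takes exactly one weight
  for each element of \<open>I\<close>.\<close>

lemma degree_split_sum:
  fixes \<alpha> \<beta> :: "'i \<Rightarrow> 'a::comm_ring_1 poly"
  assumes "finite I" "\<And>c. c \<in> I \<Longrightarrow> degree (\<alpha> c) \<le> d" "\<And>c. c \<in> I \<Longrightarrow> degree (\<beta> c) \<le> d"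
  shows "degree (split_sum (\<lambda>m n. [:k m n:]) I \<alpha> \<beta>) \<le> d * card I"
  unfolding split_sum_def
proof (rule degree_sum_le)
  fix A assume "A \<in> Pow I"
  then have A: "A \<subseteq> I" "finite A" "finite (I - A)"
    using assms finite_subset by auto
  have "degree (\<Prod>n\<in>I-A. [:k m n:]) \<le> 0 * card (I - A)" for m
    by (rule degree_prod_le) (use A in auto)
  then have "degree (\<Prod>m\<in>A. \<Prod>n\<in>I-A. [:k m n:]) \<le> 0 * card A"
    by (intro degree_prod_le) (use A in auto)
  moreover have "degree (prod \<alpha> A) \<le> d * card A" "degree (prod \<beta> (I - A)) \<le> d * card (I - A)"
    using A assms by (auto intro!: degree_prod_le)
  moreover have "card I = card A + card (I - A)"
    using A by (metis card_Un_disjoint Diff_disjoint Un_Diff_cancel sup.absorb2)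
  ultimately show "degree (prod \<alpha> A * prod \<beta> (I - A) * (\<Prod>m\<in>A. \<Prod>n\<in>I-A. [:k m n:])) \<le> d * card I"
    by (intro order.trans[OF degree_mult_le] order.trans[OF add_mono[OF degree_mult_le order.refl]])
      (simp add: distrib_left)
qed (use assms in auto)

section \<open>Symmetry of the splitting sum for generic parameters\<close>

text \<open>
  The function \<open>f (x / y)\<close> for \<open>w = \<omega>\<close> and \<open>t = \<omega>\<^sup>p\<close>, but with w and t independent, so that w can be
  perturbed: for L = 2 the poles \<open>x = \<omega> y\<close> and \<open>x = \<omega>\<^sup>-\<^sup>1 y\<close> coincide.
\<close>

definition kern :: "'a::field \<Rightarrow> 'a \<Rightarrow> 'a \<Rightarrow> 'a \<Rightarrow> 'a" where
  "kern w t x y = (x - t * y) * (x - w / t * y) / ((x - y) * (x - w * y))"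

text \<open>The hypotheses make the interpolation points 0, \<open>u c / w\<close>,
  \<open>u c\<close> and \<open>w * u c\<close> pairwise distinct. The square of \<open>w\<close>
  enters through coincidences \<open>w * u c = u d / w\<close>, for \<open>c = d\<close> as well as
  for different indices.\<close>

lemma split_sum_kern_generic:
  fixes u :: "'i \<Rightarrow> 'a::field"
  assumes "finite I" and wt: "t \<noteq> 0" "w \<noteq> 0" "w \<noteq> 1" "w\<^sup>2 \<noteq> 1"
    and "\<And>c. c \<in> I \<Longrightarrow> u c \<noteq> 0"
    and "\<And>c d. c \<in> I \<Longrightarrow> d \<in> I \<Longrightarrow> c \<noteq> d \<Longrightarrow> u c \<noteq> u d \<and> u c \<noteq> w * u d \<and> u c \<noteq> w\<^sup>2 * u d"
  shows "split_sum (\<lambda>m n. kern w t (u m) (u n)) I (\<lambda>_. x) (\<lambda>_. y) =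
         split_sum (\<lambda>m n. kern w t (u m) (u n)) I (\<lambda>_. y) (\<lambda>_. x)"
  using assms(1,6,7)
proof (induction I rule: finite_psubset_induct)
  case (psubset I)
  note nz = psubset.prems(1) and ne = psubset.prems(2)
  define k where "k = (\<lambda>m n. kern w t (u m) (u n))"
  have IH: "split_sum k J (\<lambda>_. x) (\<lambda>_. y) = split_sum k J (\<lambda>_. y) (\<lambda>_. x)" if "J \<subset> I" for J
    unfolding k_def using psubset.IH[OF that] nz ne that by (meson psubset_imp_subset subsetD)
  show ?case
  proof (cases "I = {}")
    case False
    then obtain a J where I: "I = insert a J" "a \<notin> J" by (meson Set.set_insert ex_in_conv)
    have finJ: "finite J" and aI: "a \<in> I" and JI: "J \<subset> I" using psubset.hyps I by auto
    \<comment> \<open>\<open>q z c\<close> is a common denominator of the kernel between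
      \<open>z\<close> and \<open>u c\<close> in both orders; \<open>h\<close> and \<open>h'\<close>
      are the two kernels multiplied by it. So \<open>N z\<close> is the sum over \<open>I\<close>
      with \<open>u a\<close> replaced by a variable \<open>z\<close> and with denominators
      cleared.\<close>
    define q where "q = (\<lambda>z c. (z - u c) * (z - w * u c) * (w * z - u c))"
    define h where "h = (\<lambda>z c. (z - t * u c) * (z - w / t * u c) * (w * z - u c))"
    define h' where "h' = (\<lambda>z c. (u c - t * z) * (u c - w / t * z) * (z - w * u c))"
    define N where "N = (\<lambda>z x y. x * split_sum k J (\<lambda>c. x * q z c) (\<lambda>c. y * h z c)
                                + y * split_sum k J (\<lambda>c. x * h' z c) (\<lambda>c. y * q z c))"
    have hq: "h (u b) c = q (u b) c * k b c" "h' (u b) c = q (u b) c * k c b"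
      if "b \<in> I" "c \<in> I" "b \<noteq> c" for b c
      using ne[OF that(1,2)] ne[OF that(2,1)] that
      by (auto simp: h_def h'_def q_def k_def kern_def divide_simps) (simp_all add: algebra_simps)
    \<comment> \<open>Rests on \<open>kern w t (w * r) s = kern w t s r\<close>: the shift by
      \<open>w\<close> swaps the arguments, so that only kernel values between \<open>u b\<close>
      and \<open>u c\<close> remain.\<close>
    have hw: "h (w * u b) c = q (w * u b) c * k c b" "h' (u b / w) c = q (u b / w) c * k b c"
      if "b \<in> I" "c \<in> I" "b \<noteq> c" for b c
      using ne[OF that(1,2)] ne[OF that(2,1)] that wt
      by (auto simp: h_def h'_def q_def k_def kern_def divide_simps) (simp_all add: algebra_simps)
    \<comment> \<open>The four terms record on which sides \<open>z\<close> and \<open>b\<close>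
      lie.\<close>
    have ins: "N z x y = x * (x * q z b * split_sum k J' (\<lambda>c. x * q z c) (\<lambda>c. y * h z c * k b c)
                       + y * h z b * split_sum k J' (\<lambda>c. x * q z c * k c b) (\<lambda>c. y * h z c))
                + y * (x * h' z b * split_sum k J' (\<lambda>c. x * h' z c) (\<lambda>c. y * q z c * k b c)
                       + y * q z b * split_sum k J' (\<lambda>c. x * h' z c * k c b) (\<lambda>c. y * q z c))"
      if "J = insert b J'" "b \<notin> J'" for z b J' x y
      using that finJ unfolding N_def by (simp add: split_sum_insert)
    \<comment> \<open>Terms with \<open>z\<close> and \<open>b\<close> on the same side carry the
      factor \<open>q (u b) b = 0\<close>. The two mixed terms agree up to the sign in
      \<open>h' (u b) b = - h (u b) b\<close>, because \<open>z\<close> and \<open>u b\<close>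
      coincide.\<close>
    have root1: "N (u b) x y = 0" if b: "b \<in> J" for b x y
    proof -
      obtain J' where J: "J = insert b J'" "b \<notin> J'" using b by (meson Set.set_insert)
      have "split_sum k J' (\<lambda>c. x * q (u b) c * k c b) (\<lambda>c. y * h (u b) c)
          = split_sum k J' (\<lambda>c. x * h' (u b) c) (\<lambda>c. y * q (u b) c * k b c)"
      proof (rule split_sum_cong)
        fix c assume "c \<in> J'"
        then have "b \<in> I" "c \<in> I" "b \<noteq> c" using I J by auto
        then show "x * q (u b) c * k c b = x * h' (u b) c" "y * h (u b) c = y * q (u b) c * k b c"
          by (simp_all add: hq mult_ac)
      qed simp
      moreover have "q (u b) b = 0" "h' (u b) b = - h (u b) b"
        using wt by (auto simp: q_def h_def h'_def field_simps)
      ultimately show ?thesis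
        by (simp add: ins[OF J])
    qed
    \<comment> \<open>Only the term with \<open>z\<close> in the subset and \<open>b\<close> in the
      complement survives. Both weights of each remaining \<open>c\<close> then share a factor, and
      what is left is the sum over \<open>J'\<close>, covered by the induction hypothesis.\<close>
    have root2: "N (w * u b) x y = N (w * u b) y x" if b: "b \<in> J" for b
    proof -
      obtain J' where J: "J = insert b J'" "b \<notin> J'" using b by (meson Set.set_insert)
      have "J' \<subset> I" using J I by auto
      have h_eq: "h (w * u b) c = q (w * u b) c * k c b" if "c \<in> J'" for c
      proof -
        have "b \<in> I" "c \<in> I" "b \<noteq> c" using that I J by auto
        then show ?thesis by (rule hw)
      qed
      have *: "split_sum k J' (\<lambda>c. x * q (w * u b) c * k c b) (\<lambda>c. y * h (w * u b) c)
          = (\<Prod>c\<in>J'. q (w * u b) c * k c b) * split_sum k J' (\<lambda>_. x) (\<lambda>_. y)" for x y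
        using finJ J by (subst split_sum_scale[symmetric])
          (auto simp: h_eq mult_ac intro!: split_sum_cong)
      have "q (w * u b) b = 0" "h' (w * u b) b = 0"
        by (auto simp: q_def h'_def)
      then show ?thesis
        by (simp add: ins[OF J] * IH[OF \<open>J' \<subset> I\<close>])
    qed
    \<comment> \<open>The mirror case: \<open>b\<close> lies in the subset and \<open>z\<close> in
      the complement.\<close>
    have root3: "N (u b / w) x y = N (u b / w) y x" if b: "b \<in> J" for b
    proof -
      obtain J' where J: "J = insert b J'" "b \<notin> J'" using b by (meson Set.set_insert)
      have "J' \<subset> I" using J I by auto
      have h_eq: "h' (u b / w) c = q (u b / w) c * k b c" if "c \<in> J'" for c
      proof -
        have "b \<in> I" "c \<in> I" "b \<noteq> c" using that I J by auto
        then show ?thesis by (rule hw)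
      qed
      have *: "split_sum k J' (\<lambda>c. x * h' (u b / w) c) (\<lambda>c. y * q (u b / w) c * k b c)
          = (\<Prod>c\<in>J'. q (u b / w) c * k b c) * split_sum k J' (\<lambda>_. x) (\<lambda>_. y)" for x y
        using finJ J by (subst split_sum_scale[symmetric])
          (auto simp: h_eq mult_ac intro!: split_sum_cong)
      have "q (u b / w) b = 0" "h (u b / w) b = 0"
        using wt by (auto simp: q_def h_def)
      then show ?thesis
        by (simp add: ins[OF J] * IH[OF \<open>J' \<subset> I\<close>])
    qed
    \<comment> \<open>At \<open>z = 0\<close> the kernel with any \<open>u c\<close> is 1, so
      \<open>z\<close> contributes just the symmetric factor \<open>x + y\<close>.\<close>
    have root0: "N 0 x y = N 0 y x"
    proof -
      have "h 0 = q 0" "h' 0 = q 0"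
        using wt by (auto simp: q_def h_def h'_def)
      then show ?thesis
        by (simp add: N_def split_sum_scale[OF finJ] IH[OF JI] algebra_simps)
    qed

    define Q where "Q = (\<lambda>c. [:- u c, 1:] * [:- w * u c, 1:] * [:- u c, w:])"
    define H where "H = (\<lambda>c. [:- t * u c, 1:] * [:- w / t * u c, 1:] * [:- u c, w:])"
    define H' where "H' = (\<lambda>c. [:u c, - t:] * [:u c, - w / t:] * [:- w * u c, 1:])"
    define P where "P = (\<lambda>x y.
        smult x (split_sum (\<lambda>m n. [:k m n:]) J (\<lambda>c. smult x (Q c)) (\<lambda>c. smult y (H c)))
      + smult y (split_sum (\<lambda>m n. [:k m n:]) J (\<lambda>c. smult x (H' c)) (\<lambda>c. smult y (Q c))))"
    have deg3: "degree ([:a1, b1:] * [:a2, b2:] * [:a3, b3:]) \<le> 3" for a1 b1 a2 b2 a3 b3 :: 'a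
      by (intro order.trans[OF degree_mult_le] order.trans[OF add_mono[OF degree_mult_le order.refl]])
        (simp add: degree_pCons_eq_if)
    have degQ: "degree (smult z (Q c)) \<le> 3" "degree (smult z (H c)) \<le> 3" "degree (smult z (H' c)) \<le> 3" for z c
      unfolding Q_def H_def H'_def using deg3 by (auto intro: order.trans[OF degree_smult_le])
    have degP: "degree (P x y) \<le> 3 * card J" for x y
      unfolding P_def
      by (intro degree_add_le order.trans[OF degree_smult_le] degree_split_sum finJ degQ)
    have eval: "poly (Q c) z = q z c" "poly (H c) z = h z c" "poly (H' c) z = h' z c" for c z
      unfolding Q_def H_def H'_def q_def h_def h'_def poly_mult by (simp_all add: mult.commute)
    have polyP: "poly (P x y) z = N z x y" for x y z
      by (simp add: P_def N_def poly_split_sum eval)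
    define R where "R = P x y - P y x"
    \<comment> \<open>The values 0, 1, 2 of \<open>j\<close> give \<open>u c / w\<close>,
      \<open>u c\<close> and \<open>w * u c\<close>.\<close>
    define pt where "pt = (\<lambda>(c, j::nat). u c * w ^ j / w)"
    define X where "X = insert 0 (pt ` (J \<times> {0,1,2}))"
    have injpt: "inj_on pt (J \<times> {0,1,2})"
    proof -
      have "w\<^sup>2 \<noteq> w" using wt by (simp add: power2_eq_square)
      have "pt (c, i) \<noteq> pt (d, j)" if "c \<in> J" "d \<in> J" "c \<noteq> d" "i \<in> {0,1,2}" "j \<in> {0,1,2}" for c d i j
        using that ne[of c d] ne[of d c] wt I
        by (auto simp: pt_def mult_ac power2_eq_square)
      moreover have "pt (c, i) \<noteq> pt (c, j)" if "c \<in> J" "i \<in> {0,1,2}" "j \<in> {0,1,2}" "i \<noteq> j" for c i j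
        using that nz[of c] wt \<open>w\<^sup>2 \<noteq> w\<close> I by (auto simp: pt_def)
      ultimately show ?thesis unfolding inj_on_def by (metis mem_Sigma_iff prod.exhaust)
    qed
    have "0 \<notin> pt ` (J \<times> {0,1,2})"
      using nz wt I by (auto simp: pt_def)
    then have cardX: "card X = Suc (3 * card J)"
      unfolding X_def using finJ injpt by (simp add: card_image card_cartesian_product)
    have rootsX: "X \<subseteq> {z. poly R z = 0}"
      using root0 root1 root2 root3 wt
      by (auto simp: X_def R_def polyP pt_def power2_eq_square mult.commute)
    have "R = 0"
    proof (rule ccontr)
      assume "R \<noteq> 0"
      have "card X \<le> card {z. poly R z = 0}"
        by (rule card_mono[OF poly_roots_finite[OF \<open>R \<noteq> 0\<close>] rootsX])
      also have "\<dots> \<le> degree R"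
        by (rule card_poly_roots_bound[OF \<open>R \<noteq> 0\<close>])
      also have "\<dots> \<le> 3 * card J"
        unfolding R_def by (intro degree_diff_le degP)
      finally show False using cardX by simp
    qed
    then have "N (u a) x y = N (u a) y x"
      using polyP by (metis R_def eq_iff_diff_eq_0)
    \<comment> \<open>Back at \<open>z = u a\<close>, clearing denominators is undone:
      \<open>N\<close> is the desired sum times a product that does not depend on \<open>x\<close>
      and \<open>y\<close> and is nonzero by genericity.\<close>
    moreover have "N (u a) x y = (\<Prod>c\<in>J. q (u a) c) * split_sum k I (\<lambda>_. x) (\<lambda>_. y)" for x y
    proof -
      have h_eq: "h (u a) c = q (u a) c * k a c" "h' (u a) c = q (u a) c * k c a" if "c \<in> J" for c
      proof -
        have "c \<in> I" "a \<noteq> c" using that I by auto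
        then show "h (u a) c = q (u a) c * k a c" "h' (u a) c = q (u a) c * k c a"
          using hq aI by blast+
      qed
      have "split_sum k J (\<lambda>c. x * q (u a) c) (\<lambda>c. y * h (u a) c)
          = (\<Prod>c\<in>J. q (u a) c) * split_sum k J (\<lambda>_. x) (\<lambda>c. y * k a c)"
        using finJ by (subst split_sum_scale[symmetric])
          (auto simp: h_eq mult_ac intro!: split_sum_cong)
      moreover have "split_sum k J (\<lambda>c. x * h' (u a) c) (\<lambda>c. y * q (u a) c)
          = (\<Prod>c\<in>J. q (u a) c) * split_sum k J (\<lambda>c. x * k c a) (\<lambda>_. y)"
        using finJ by (subst split_sum_scale[symmetric])
          (auto simp: h_eq mult_ac intro!: split_sum_cong)
      ultimately show ?thesis
        unfolding N_def I(1) using I finJ by (simp add: split_sum_insert algebra_simps)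
    qed
    moreover have "(\<Prod>c\<in>J. q (u a) c) \<noteq> 0"
    proof -
      have "q (u a) c \<noteq> 0" if "c \<in> J" for c
      proof -
        have "c \<in> I" "a \<noteq> c" using that I by auto
        then show ?thesis
          using ne[of a c] ne[of c a] aI by (auto simp: q_def)
      qed
      then show ?thesis using finJ by simp
    qed
    ultimately show ?thesis by (simp add: k_def)
  qed simp
qed

section \<open>Removing the genericity assumptions\<close>

lemma eventually_scaled_exp_ne:
  fixes c :: complex and \<kappa> :: real
  assumes "\<kappa> \<noteq> 0"
  shows "eventually (\<lambda>\<epsilon>. c * of_real (exp (\<kappa> * \<epsilon>)) \<noteq> 1) (at_right 0)"
\<comment> \<open>Since \<open>exp\<close> is injective and \<open>\<kappa>\<close> is nonzero, at
  most one argument solves the equation; a short interval to the right of 0 avoids it.\<close>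
proof (cases "\<exists>e>0. c * of_real (exp (\<kappa> * e)) = 1")
  case True
  then obtain e where e: "e > 0" "c * of_real (exp (\<kappa> * e)) = 1" by blast
  have "c * of_real (exp (\<kappa> * \<epsilon>)) \<noteq> 1" if "\<epsilon> < e" for \<epsilon>
  proof
    assume "c * of_real (exp (\<kappa> * \<epsilon>)) = 1"
    with e have "of_real (exp (\<kappa> * \<epsilon>)) = (of_real (exp (\<kappa> * e)) :: complex)"
      by (metis mult_cancel_left mult_zero_left zero_neq_one)
    then have "\<kappa> * \<epsilon> = \<kappa> * e" by (simp only: of_real_eq_iff exp_inj_iff)
    with assms that show False by simp
  qed
  with e(1) show ?thesis by (auto simp: eventually_at_right_field)
next
  case False
  then show ?thesis by (auto simp: eventually_at_right_field intro!: exI[of _ 1])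
qed

text \<open>Only zeros of the denominators are excluded here. Both sides are limits of generic
  instances in which \<open>w\<close> and the \<open>u c\<close> are rescaled; indices are natural
  numbers because they supply the different growth rates.\<close>

lemma split_sum_kern_symmetric:
  fixes u :: "nat \<Rightarrow> complex"
  assumes "finite I" and wt: "t \<noteq> 0" "w \<noteq> 0"
    and nz: "\<And>c. c \<in> I \<Longrightarrow> u c \<noteq> 0"
    and ne: "\<And>c d. c \<in> I \<Longrightarrow> d \<in> I \<Longrightarrow> c \<noteq> d \<Longrightarrow> u c \<noteq> u d \<and> u c \<noteq> w * u d"
  shows "split_sum (\<lambda>m n. kern w t (u m) (u n)) I (\<lambda>_. x) (\<lambda>_. y) =
         split_sum (\<lambda>m n. kern w t (u m) (u n)) I (\<lambda>_. y) (\<lambda>_. x)"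
proof -
  \<comment> \<open>The exponents 3 c of the \<open>u c\<close> and 1 of w are such that no coincidence
    \<open>u c = w ^ j * u d\<close>, j = 0, 1, 2, persists under the perturbation.\<close>
  define e where "e = (\<lambda>\<kappa> \<epsilon>. complex_of_real (exp (\<kappa> * \<epsilon>)))"
  define W where "W = (\<lambda>\<epsilon>. w * e 1 \<epsilon>)"
  define U where "U = (\<lambda>\<epsilon> c. u c * e (3 * real c) \<epsilon>)"
  have e_nz: "e \<kappa> \<epsilon> \<noteq> 0" for \<kappa> \<epsilon> by (simp add: e_def)
  have e_mult: "e \<kappa> \<epsilon> * e \<kappa>' \<epsilon> = e (\<kappa> + \<kappa>') \<epsilon>" for \<kappa> \<kappa>' \<epsilon>
    by (simp add: e_def distrib_right exp_add)
  have e_lim: "(e \<kappa> \<longlongrightarrow> 1) (at_right 0)" for \<kappa>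
    unfolding e_def by (rule tendsto_eq_intros refl | simp)+
  have W_lim: "(W \<longlongrightarrow> w) (at_right 0)"
    using tendsto_mult_left[OF e_lim, of w 1] by (simp add: W_def)
  have U_lim: "((\<lambda>\<epsilon>. U \<epsilon> c) \<longlongrightarrow> u c) (at_right 0)" for c
    using tendsto_mult_left[OF e_lim, of "u c"] by (simp add: U_def)
  have lim: "((\<lambda>\<epsilon>. split_sum (\<lambda>m n. kern (W \<epsilon>) t (U \<epsilon> m) (U \<epsilon> n)) I (\<lambda>_. x) (\<lambda>_. y)) \<longlongrightarrow>
      split_sum (\<lambda>m n. kern w t (u m) (u n)) I (\<lambda>_. x) (\<lambda>_. y)) (at_right 0)" for x y
  proof -
    have "((\<lambda>\<epsilon>. kern (W \<epsilon>) t (U \<epsilon> m) (U \<epsilon> n)) \<longlongrightarrow> kern w t (u m) (u n)) (at_right 0)"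
      if "A \<subseteq> I" "m \<in> A" "n \<in> I - A" for A m n
      unfolding kern_def using ne[of m n] that wt by (intro tendsto_intros W_lim U_lim) auto
    then show ?thesis
      unfolding split_sum_def by (intro tendsto_sum tendsto_mult tendsto_const tendsto_prod) blast
  qed
  have gen: "eventually (\<lambda>\<epsilon>. U \<epsilon> c \<noteq> W \<epsilon> ^ j * U \<epsilon> d) (at_right 0)"
    if "c \<in> I" "d \<in> I" "c \<noteq> d" "j \<in> {0,1,2}" for c d j
  proof -
    \<comment> \<open>For \<open>j = 0\<close> this is \<open>c \<noteq> d\<close>; for
      \<open>j = 1\<close> and \<open>j = 2\<close> it holds modulo 3.\<close>
    have "3 * int c \<noteq> int j + 3 * int d" using that by auto
    then have "real j + 3 * real d - 3 * real c \<noteq> 0" by linarith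
    then have "eventually (\<lambda>\<epsilon>. w ^ j * u d / u c * e (real j + 3 * real d - 3 * real c) \<epsilon> \<noteq> 1) (at_right 0)"
      unfolding e_def by (rule eventually_scaled_exp_ne)
    then show ?thesis
    proof (rule eventually_mono)
      fix \<epsilon>
      assume 1: "w ^ j * u d / u c * e (real j + 3 * real d - 3 * real c) \<epsilon> \<noteq> 1"
      show "U \<epsilon> c \<noteq> W \<epsilon> ^ j * U \<epsilon> d"
      proof
        assume 2: "U \<epsilon> c = W \<epsilon> ^ j * U \<epsilon> d"
        have "e 1 \<epsilon> ^ j = e (real j) \<epsilon>"
          by (simp add: e_def flip: exp_of_nat_mult of_real_power)
        with 2 have "u c * e (3 * real c) \<epsilon> = w ^ j * u d * (e (real j) \<epsilon> * e (3 * real d) \<epsilon>)"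
          by (simp add: U_def W_def power_mult_distrib mult_ac)
        also have "e (real j) \<epsilon> * e (3 * real d) \<epsilon> = e (real j + 3 * real d - 3 * real c) \<epsilon> * e (3 * real c) \<epsilon>"
          by (simp add: e_mult)
        finally have "u c = w ^ j * u d * e (real j + 3 * real d - 3 * real c) \<epsilon>"
          using e_nz by (simp flip: mult.assoc)
        with 1 nz[OF that(1)] show False by (simp add: field_simps)
      qed
    qed
  qed
  have W1: "eventually (\<lambda>\<epsilon>. W \<epsilon> \<noteq> 1) (at_right 0)"
    unfolding W_def e_def by (rule eventually_scaled_exp_ne) simp
  have "eventually (\<lambda>\<epsilon>. w\<^sup>2 * e 2 \<epsilon> \<noteq> 1) (at_right 0)"
    unfolding e_def by (rule eventually_scaled_exp_ne) simp
  moreover have "(W \<epsilon>)\<^sup>2 = w\<^sup>2 * e 2 \<epsilon>" for \<epsilon>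
    using e_mult[of 1 \<epsilon> 1] by (simp add: W_def power2_eq_square mult_ac)
  ultimately have W2: "eventually (\<lambda>\<epsilon>. (W \<epsilon>)\<^sup>2 \<noteq> 1) (at_right 0)" by simp
  have "eventually (\<lambda>\<epsilon>. \<forall>c\<in>I. \<forall>d\<in>I. \<forall>j\<in>{0,1,2}. c \<noteq> d \<longrightarrow> U \<epsilon> c \<noteq> W \<epsilon> ^ j * U \<epsilon> d) (at_right 0)"
    using assms(1) gen by (intro eventually_ball_finite ballI) (auto simp: eventually_conj_iff)
  with W1 W2 have "eventually (\<lambda>\<epsilon>.
      split_sum (\<lambda>m n. kern (W \<epsilon>) t (U \<epsilon> m) (U \<epsilon> n)) I (\<lambda>_. x) (\<lambda>_. y) =
      split_sum (\<lambda>m n. kern (W \<epsilon>) t (U \<epsilon> m) (U \<epsilon> n)) I (\<lambda>_. y) (\<lambda>_. x)) (at_right 0)"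
  proof eventually_elim
    case (elim \<epsilon>)
    show ?case
      by (rule split_sum_kern_generic)
        (use elim assms(1) wt nz e_nz in \<open>auto simp: W_def U_def\<close>)
  qed
  from tendsto_cong[THEN iffD2, OF this lim] show ?thesis
    by (rule tendsto_unique[OF trivial_limit_at_right_real lim])
qed

section \<open>Factorization of the summands\<close>

lemma omega_pow_add: "omega_pow L (c + d) = omega_pow L c * omega_pow L d"
  by (simp add: omega_pow_def distrib_left add_divide_distrib exp_add)

lemma omega_pow_nonzero [simp]: "omega_pow L c \<noteq> 0"
  by (simp add: omega_pow_def)

lemma omega_pow_sum: "omega_pow L (sum g A) = (\<Prod>s\<in>A. omega_pow L (g s))"
  by (cases "finite A", induction A rule: finite_induct)
    (auto simp: omega_pow_add, auto simp: omega_pow_def)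

lemma omega_pow_0: "omega_pow L 0 = 1"
  by (simp add: omega_pow_def)

lemma f_divide_eq_kern:
  assumes "y \<noteq> 0"
  shows "f L p (x / y) = kern (omega_pow L 1) (omega_pow L (of_real p)) x y"
proof -
  have t: "omega_pow L (1 - of_real p) = omega_pow L 1 / omega_pow L (of_real p)"
    using omega_pow_add[of L "1 - of_real p" "of_real p"] by (simp add: field_simps)
  have *: "x / y - c = (x - c * y) / y" for c
    using assms by (simp add: field_simps)
  have "x / y - 1 = (x - y) / y" using assms by (simp add: field_simps)
  then show ?thesis
    using assms unfolding f_def t kern_def * by simp
qed

text \<open>This is \<open>f (\<omega> / z) = f z\<close> in homogeneous form, with
  \<open>z = y / x\<close>: numerator and denominator both gain a factor \<open>w\<close>.\<close>

lemma kern_reflect: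
  assumes "t \<noteq> 0" "w \<noteq> 0"
  shows "kern w t (w * x) y = kern w t y x"
proof -
  have "(w * x - t * y) * (w * x - w / t * y) = w * ((y - t * x) * (y - w / t * x))"
    using assms by (simp add: field_simps)
  moreover have "(w * x - y) * (w * x - w * y) = w * ((y - x) * (y - w * x))"
    by (simp add: algebra_simps)
  ultimately show ?thesis
    unfolding kern_def using assms by simp
qed

text \<open>The shape of the reflection needed for a set containing both \<open>i\<close> and
  \<open>i + 1\<close>, whose variables differ by the factor
  \<open>omega_pow L (-1)\<close>.\<close>

lemma f_reflect:
  assumes "x \<noteq> 0" "y \<noteq> 0"
  shows "f L p (x / (y * omega_pow L (-1))) = f L p (y / x)"
proof -
  have "omega_pow L (-1) * omega_pow L 1 = 1"
    by (simp add: omega_pow_0 flip: omega_pow_add)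
  then have "x / (y * omega_pow L (-1)) = omega_pow L 1 * x / y"
    using assms by (simp add: field_simps)
  then show ?thesis
    using assms by (simp add: f_divide_eq_kern kern_reflect)
qed

section \<open>Ranks of elements in a set\<close>

definition rank :: "nat set \<Rightarrow> nat \<Rightarrow> nat" where
  "rank S s = card {r \<in> S. r \<le> s}"

text \<open>\<open>rank S\<close> inverts the numbering \<open>elt S\<close>: the members of
  \<open>S\<close> not exceeding the \<open>j\<close>-th entry of the sorted list are its first
  \<open>j\<close> entries.\<close>

lemma
  assumes "finite S" "j \<in> {1..card S}"
  shows elt_mem: "elt S j \<in> S" and rank_elt: "rank S (elt S j) = j"
proof -
  define l where "l = sorted_list_of_set S"
  have l: "set l = S" "distinct l" "sorted l" "length l = card S"
    using assms by (auto simp: l_def)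
  have j: "j - 1 < length l" "j - 1 + 1 = j" using assms l by auto
  show "elt S j \<in> S" using j l unfolding elt_def l_def[symmetric] by auto
  \<comment> \<open>\<open>elt\<close> counts from 1 and list positions from 0, so
    \<open>{..j - 1}\<close> has \<open>j\<close> elements.\<close>
  have "{r \<in> S. r \<le> l ! (j - 1)} = (!) l ` {..j - 1}"
  proof safe
    fix r assume "r \<in> S" "r \<le> l ! (j - 1)"
    then obtain i where i: "i < length l" "r = l ! i" using l by (metis in_set_conv_nth)
    have "i \<le> j - 1"
    proof (rule ccontr)
      assume "\<not> i \<le> j - 1"
      then have "l ! (j - 1) \<le> l ! i" "l ! (j - 1) \<noteq> l ! i"
        using l i j by (auto simp: sorted_nth_mono nth_eq_iff_index_eq)
      with i \<open>r \<le> _\<close> show False by simp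
    qed
    with i show "r \<in> (!) l ` {..j - 1}" by auto
  next
    fix i assume "i \<le> j - 1"
    then show "l ! i \<in> S" "l ! i \<le> l ! (j - 1)" using l j by (auto simp: sorted_nth_mono)
  qed
  moreover have "inj_on ((!) l) {..j - 1}"
    using l j by (auto simp: inj_on_def nth_eq_iff_index_eq)
  ultimately show "rank S (elt S j) = j"
    unfolding rank_def elt_def l_def[symmetric] using j by (simp add: card_image)
qed

lemma bij_betw_elt:
  assumes "finite S"
  shows "bij_betw (elt S) {1..card S} S"
proof -
  have "inj_on (elt S) {1..card S}"
    using rank_elt[OF assms] by (metis inj_onI)
  moreover have "elt S ` {1..card S} \<subseteq> S" using elt_mem[OF assms] by auto
  ultimately show ?thesis
    by (simp add: bij_betw_def assms card_image card_subset_eq)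
qed

text \<open>\<open>g\<close> receives both element and position: the factors of \<open>Phi\<close>
  compare elements but find their variables by position.\<close>

lemma prod_elt:
  assumes "finite S"
  shows "(\<Prod>j\<in>{1..card S}. g (elt S j) j) = (\<Prod>s\<in>S. g s (rank S s))"
proof -
  have "(\<Prod>j\<in>{1..card S}. g (elt S j) j) = (\<Prod>j\<in>{1..card S}. g (elt S j) (rank S (elt S j)))"
    by (rule prod.cong) (use rank_elt[OF assms] in auto)
  also have "\<dots> = (\<Prod>s\<in>S. g s (rank S s))"
    by (rule prod.reindex_bij_betw[OF bij_betw_elt[OF assms]])
  finally show ?thesis .
qed

lemma elt_rank:
  assumes "finite S" "s \<in> S"
  shows "rank S s \<in> {1..card S}" "elt S (rank S s) = s"
proof -
  obtain j where "j \<in> {1..card S}" "elt S j = s"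
    using bij_betw_elt[OF assms(1)] assms(2) by (metis bij_betw_imp_surj_on imageE)
  then show "rank S s \<in> {1..card S}" "elt S (rank S s) = s"
    using rank_elt[OF assms(1)] by auto
qed

lemma rank_Suc:
  assumes "finite S" "i + 1 \<in> S"
  shows "rank S (i + 1) = rank S i + 1"
proof -
  have "{r \<in> S. r \<le> i + 1} = insert (i + 1) {r \<in> S. r \<le> i}" using assms by auto
  then show ?thesis unfolding rank_def using assms by simp
qed

lemma inj_on_transpose: "inj_on (transpose a b) A"
  by (rule inj_on_subset[OF bij_is_inj[OF bij_transpose]]) simp

text \<open>As \<open>i + 1\<close> is vacant, at most \<open>i\<close> moves, into the adjacent
  free place, and the order within the set is preserved.\<close>

lemma rank_transpose:
  assumes "i + 1 \<notin> S" "s \<in> S"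
  shows "rank (transpose i (i + 1) ` S) (transpose i (i + 1) s) = rank S s"
proof -
  have le: "transpose i (i + 1) r \<le> transpose i (i + 1) s \<longleftrightarrow> r \<le> s" if "r \<in> S" for r
    using that assms by (auto simp: transpose_def le_Suc_eq)
  have "{r \<in> transpose i (i + 1) ` S. r \<le> transpose i (i + 1) s} = transpose i (i + 1) ` {r \<in> S. r \<le> s}"
    using le by auto
  then show ?thesis unfolding rank_def by (simp add: card_image inj_on_transpose)
qed

section \<open>Factors belonging to a pair of sets\<close>

definition pair_factor :: "nat \<Rightarrow> real \<Rightarrow> nat \<Rightarrow> nat \<Rightarrow> complex \<Rightarrow> complex \<Rightarrow> complex" where
  "pair_factor L p s s' y y' =
     (if s < s' then f L p (y / y') else if s > s' then f L p (y' / y) else 1)"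

text \<open>Indexing by elements instead of positions lets the exchange of \<open>i\<close> and
  \<open>i + 1\<close> act as a relabelling.\<close>

definition block ::
  "nat \<Rightarrow> real \<Rightarrow> nat set \<Rightarrow> nat set \<Rightarrow> (nat \<Rightarrow> complex) \<Rightarrow> (nat \<Rightarrow> complex) \<Rightarrow> complex" where
  "block L p S S' Y Y' =
     (\<Prod>s\<in>S. \<Prod>s'\<in>S'. pair_factor L p s s' (Y (rank S s)) (Y' (rank S' s')))"

lemma pair_factor_commute: "pair_factor L p s s' y y' = pair_factor L p s' s y' y"
  by (auto simp: pair_factor_def)

lemma block_commute: "block L p S S' Y Y' = block L p S' S Y' Y"
  unfolding block_def by (subst prod.swap) (simp add: pair_factor_commute)

lemma Phi_eq_prod_block:
  assumes "S \<in> set_tuples L N ks"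
  shows "Phi L p N ks S x =
    (\<Prod>n\<in>{1..N}. \<Prod>m\<in>{1..<n}. block L p (S m) (S n) (yvar L ks x m) (yvar L ks x n))"
  unfolding Phi_def
proof (intro prod.cong refl)
  fix n m assume nm: "n \<in> {1..N}" "m \<in> {1..<n}"
  have "finite (S j) \<and> card (S j) = ks j" if "j \<in> {1..N}" for j
    using assms that finite_subset unfolding set_tuples_def by blast
  with nm have S: "finite (S m)" "card (S m) = ks m" "finite (S n)" "card (S n) = ks n"
    by auto
  show "(\<Prod>j\<in>{1..ks m}. \<Prod>j'\<in>{1..ks n}.
        (if elt (S m) j < elt (S n) j' then f L p (yvar L ks x m j / yvar L ks x n j')
         else if elt (S m) j > elt (S n) j' then f L p (yvar L ks x n j' / yvar L ks x m j)
         else 1)) = block L p (S m) (S n) (yvar L ks x m) (yvar L ks x n)"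
    unfolding S(2)[symmetric] S(4)[symmetric] block_def pair_factor_def
    by (subst prod_elt[OF S(1), symmetric], subst prod_elt[OF S(3), symmetric]) (rule refl)
qed

text \<open>There are two maps because each set is flipped or kept independently. Preserved ranks
  mean preserved variables, so only the comparisons of elements change.\<close>

lemma block_image:
  assumes "inj_on g S" "inj_on g' S'"
    and "\<And>s. s \<in> S \<Longrightarrow> rank (g ` S) (g s) = rank S s"
    and "\<And>s. s \<in> S' \<Longrightarrow> rank (g' ` S') (g' s) = rank S' s"
  shows "block L p (g ` S) (g' ` S') Y Y' =
    (\<Prod>s\<in>S. \<Prod>s'\<in>S'. pair_factor L p (g s) (g' s') (Y (rank S s)) (Y' (rank S' s')))"
  unfolding block_def using assms by (simp add: prod.reindex)

text \<open>The relabelling can affect only the comparison at \<open>(i, i)\<close>, whose factor is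
  1 beforehand. A nontrivial new factor arises only if exactly one of the two sets is
  flipped.\<close>

lemma block_transpose_active:
  assumes "finite S" "finite S'" "i \<in> S" "i + 1 \<notin> S" "i \<in> S'" "i + 1 \<notin> S'"
    and g: "g \<in> {id, transpose i (i + 1)}" and g': "g' \<in> {id, transpose i (i + 1)}"
  shows "block L p (g ` S) (g' ` S') Y Y' =
    block L p S S' Y Y' * pair_factor L p (g i) (g' i) (Y (rank S i)) (Y' (rank S' i))"
proof -
  let ?P = "\<lambda>s s'. pair_factor L p s s' (Y (rank S s)) (Y' (rank S' s'))"
  let ?Q = "\<lambda>s s'. pair_factor L p (g s) (g' s') (Y (rank S s)) (Y' (rank S' s'))"
  have rest: "?Q s s' = ?P s s'" if "s \<in> S" "s' \<in> S'" "(s, s') \<noteq> (i, i)" for s s'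
  proof -
    have "s \<noteq> i + 1" "s' \<noteq> i + 1" using that assms by auto
    then have "(g s < g' s') = (s < s') \<and> (g s > g' s') = (s > s')"
      using g g' that(3) by (auto simp: transpose_def split: if_splits)
    then show ?thesis by (simp add: pair_factor_def)
  qed
  have S: "S \<times> S' = insert (i, i) (S \<times> S' - {(i, i)})" using assms by auto
  have fin: "finite (S \<times> S' - {(i, i)})" using assms by auto
  have "block L p (g ` S) (g' ` S') Y Y' = (\<Prod>(s, s')\<in>S \<times> S'. ?Q s s')"
    unfolding prod.cartesian_product[symmetric]
    by (rule block_image) (use g g' rank_transpose assms in \<open>auto simp: inj_on_transpose\<close>)
  also have "\<dots> = ?Q i i * (\<Prod>(s, s')\<in>S \<times> S' - {(i, i)}. ?Q s s')"
    by (subst S, subst prod.insert[OF fin]) auto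
  also have "(\<Prod>(s, s')\<in>S \<times> S' - {(i, i)}. ?Q s s') = (\<Prod>(s, s')\<in>S \<times> S' - {(i, i)}. ?P s s')"
    by (rule prod.cong) (use rest in auto)
  \<comment> \<open>Equal elements have pair factor 1.\<close>
  also have "\<dots> = ?P i i * (\<Prod>(s, s')\<in>S \<times> S' - {(i, i)}. ?P s s')"
    by (simp add: pair_factor_def)
  also have "\<dots> = (\<Prod>(s, s')\<in>S \<times> S'. ?P s s')"
    by (subst (2) S, subst prod.insert[OF fin]) auto
  also have "\<dots> = block L p S S' Y Y'"
    unfolding block_def prod.cartesian_product ..
  finally show ?thesis by (simp add: mult.commute)
qed

text \<open>If \<open>S'\<close> contains neither \<open>i\<close> nor \<open>i + 1\<close>, no
  comparison changes. If it contains both, the factor of \<open>i\<close> in \<open>S\<close> with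
  \<open>i + 1\<close> in \<open>S'\<close> is traded for the factor of \<open>i + 1\<close> with
  \<open>i\<close> in \<open>S'\<close>; these agree by \<open>f_reflect\<close>.\<close>

lemma block_transpose_inactive:
  assumes "finite S'" "i \<in> S" "i + 1 \<notin> S" "i \<in> S' \<longleftrightarrow> i + 1 \<in> S'"
    and nz: "\<And>j. Y j \<noteq> 0" "\<And>j. Y' j \<noteq> 0"
    and shift: "\<And>j. Y' (j + 1) = Y' j * omega_pow L (-1)"
  shows "block L p (transpose i (i + 1) ` S) S' Y Y' = block L p S S' Y Y'"
proof -
  let ?\<tau> = "transpose i (i + 1)"
  have "block L p (?\<tau> ` S) (id ` S') Y Y'
      = (\<Prod>s\<in>S. \<Prod>s'\<in>S'. pair_factor L p (?\<tau> s) (id s') (Y (rank S s)) (Y' (rank S' s')))"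
    by (rule block_image) (use rank_transpose assms in \<open>auto simp: inj_on_transpose\<close>)
  also have "\<dots> = block L p S S' Y Y'"
    unfolding block_def
  proof (rule prod.cong[OF refl])
    fix s assume "s \<in> S"
    show "(\<Prod>s'\<in>S'. pair_factor L p (?\<tau> s) (id s') (Y (rank S s)) (Y' (rank S' s')))
        = (\<Prod>s'\<in>S'. pair_factor L p s s' (Y (rank S s)) (Y' (rank S' s')))"
    proof (cases "s = i")
      case False
      then have "?\<tau> s = s" using \<open>s \<in> S\<close> assms by (auto simp: transpose_def)
      then show ?thesis by simp
    next
      case True
      have rest: "pair_factor L p (i + 1) s' y y' = pair_factor L p i s' y y'"
        if "s' \<noteq> i" "s' \<noteq> i + 1" for s' y y'
        using that by (auto simp: pair_factor_def)
      show ?thesis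
      proof (cases "i \<in> S'")
        case False
        then have "s' \<noteq> i \<and> s' \<noteq> i + 1" if "s' \<in> S'" for s' using that assms by auto
        then show ?thesis using True rest by (intro prod.cong) auto
      next
        case both: True
        define R where "R = S' - {i, i + 1}"
        have S': "S' = insert i (insert (i + 1) R)" and R: "finite R" "i \<notin> R" "i + 1 \<notin> R"
          using both assms by (auto simp: R_def)
        let ?u = "Y (rank S i)" and ?y = "Y' (rank S' i)"
        have y: "Y' (rank S' (i + 1)) = ?y * omega_pow L (-1)"
          using shift rank_Suc[OF assms(1)] both assms by simp
        have split: "(\<Prod>s'\<in>S'. g s') = g i * (g (i + 1) * prod g R)" for g :: "nat \<Rightarrow> complex"
          by (subst S') (use R in simp)
        have "(\<Prod>s'\<in>S'. pair_factor L p (i + 1) s' ?u (Y' (rank S' s')))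
            = f L p (?y / ?u) * (\<Prod>s'\<in>R. pair_factor L p (i + 1) s' ?u (Y' (rank S' s')))"
          unfolding split by (simp add: pair_factor_def)
        also have "(\<Prod>s'\<in>R. pair_factor L p (i + 1) s' ?u (Y' (rank S' s')))
            = (\<Prod>s'\<in>R. pair_factor L p i s' ?u (Y' (rank S' s')))"
          by (rule prod.cong[OF refl], rule rest) (use R in auto)
        also have "f L p (?y / ?u) * \<dots> = (\<Prod>s'\<in>S'. pair_factor L p i s' ?u (Y' (rank S' s')))"
          unfolding split y using f_reflect[OF nz] by (simp add: pair_factor_def)
        finally show ?thesis using True by simp
      qed
    qed
  qed
  finally show ?thesis by simp
qed

text \<open>Passes from pairs \<open>m < n\<close> to all ordered pairs, so that the product can be
  restricted to \<open>A\<close> times its complement.\<close>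

lemma prod_triangle:
  fixes h :: "nat \<Rightarrow> nat \<Rightarrow> 'a::comm_monoid_mult"
  assumes "\<And>n. h n n = 1"
  shows "(\<Prod>n\<in>{1..N}. \<Prod>m\<in>{1..<n}. h m n * h n m) = (\<Prod>m\<in>{1..N}. \<Prod>n\<in>{1..N}. h m n)"
proof (induction N)
  case (Suc N)
  have "{1..<Suc N} = {1..N}" by auto
  with Suc show ?case
    using assms by (simp add: prod.distrib mult_ac)
qed simp

text \<open>The trace-zero condition removes the \<open>1 / L\<close> terms of the fundamental
  weights.\<close>

lemma form_set_weight:
  assumes "a \<in> hstar L" "S \<subseteq> {1..L}"
  shows "form L a (set_weight L S) = sum a S"
proof -
  have "form L a (fund_weight L s) = a s" if "s \<in> {1..L}" for s
  proof -
    have "form L a (fund_weight L s) = (\<Sum>j=1..L. a j * of_bool (j = s) - a j * (1 / of_nat L))"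
      unfolding form_def by (intro sum.cong) (auto simp: fund_weight_def right_diff_distrib)
    also have "\<dots> = (\<Sum>j=1..L. a j * of_bool (j = s)) - (\<Sum>j=1..L. a j) * (1 / of_nat L)"
      by (simp only: sum_subtractf sum_distrib_right)
    finally show ?thesis
      using assms(1) sum_single[OF that] by (simp add: hstar_def)
  qed
  moreover have "form L a (set_weight L S) = (\<Sum>s\<in>S. form L a (fund_weight L s))"
    unfolding form_def set_weight_def sum_distrib_left by (rule sum.swap)
  ultimately show ?thesis using assms(2) by (simp add: subset_iff)
qed

lemma omega_pow_form_set_tuple:
  assumes "a \<in> hstar L" "S \<in> set_tuples L N ks"
  shows "omega_pow L (form L a (\<lambda>i. \<Sum>n=1..N. set_weight L (S n) i))
       = (\<Prod>n=1..N. omega_pow L (sum a (S n)))"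
proof -
  have "form L a (\<lambda>i. \<Sum>n=1..N. set_weight L (S n) i) = (\<Sum>n=1..N. form L a (set_weight L (S n)))"
    unfolding form_def sum_distrib_left by (rule sum.swap)
  also have "\<dots> = (\<Sum>n=1..N. sum a (S n))"
    by (intro sum.cong refl form_set_weight assms) (use assms in \<open>auto simp: set_tuples_def PiE_iff\<close>)
  finally show ?thesis by (simp add: omega_pow_sum)
qed

lemma simple_reflection_eq_transpose:
  assumes "i \<in> {1..L-1}"
  shows "simple_reflection L i a = a \<circ> transpose i (i + 1)"
  unfolding simple_reflection_def form_simple_root[OF assms]
  by (rule ext) (auto simp: simple_root_def transpose_def)

section \<open>Exchanging i and i + 1\<close>

text \<open>
  Each class of tuples has exactly one member none of whose sets contains i + 1 without i; the
  others arise from it by \<open>flip_outside\<close>.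
\<close>

definition canonical :: "nat \<Rightarrow> nat \<Rightarrow> (nat \<Rightarrow> nat set) \<Rightarrow> nat \<Rightarrow> nat set" where
  "canonical i N S =
     (\<lambda>n. if n \<in> {1..N} \<and> i \<notin> S n \<and> i + 1 \<in> S n then transpose i (i + 1) ` S n else S n)"

text \<open>Meant for canonical tuples, where these are all the positions whose set contains exactly
  one of \<open>i\<close> and \<open>i + 1\<close>.\<close>

definition active :: "nat \<Rightarrow> nat \<Rightarrow> (nat \<Rightarrow> nat set) \<Rightarrow> nat set" where
  "active i N S = {n \<in> {1..N}. i \<in> S n \<and> i + 1 \<notin> S n}"

definition flip_outside :: "nat \<Rightarrow> nat \<Rightarrow> (nat \<Rightarrow> nat set) \<Rightarrow> nat set \<Rightarrow> nat \<Rightarrow> nat set" where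
  "flip_outside i N S A =
     (\<lambda>n. if n \<in> active i N S - A then transpose i (i + 1) ` S n else S n)"

text \<open>Positions outside \<open>{1..N}\<close> stay untouched, which keeps the tuple
  extensional.\<close>

lemma transpose_image_set_tuples:
  assumes "S \<in> set_tuples L N ks" "i \<in> {1..L-1}" "B \<subseteq> {1..N}"
  shows "(\<lambda>n. if n \<in> B then transpose i (i + 1) ` S n else S n) \<in> set_tuples L N ks"
proof -
  have "transpose i (i + 1) ` T \<subseteq> {1..L}" if "T \<subseteq> {1..L}" for T
    using that assms(2) by (auto simp: transpose_def)
  moreover have "card (transpose i (i + 1) ` T) = card T" for T
    by (simp add: card_image inj_on_transpose)
  ultimately show ?thesis
    using assms(1,3) unfolding set_tuples_def by (auto simp: PiE_iff extensional_def)
qed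

lemma flip_outside_set_tuples:
  assumes "S \<in> set_tuples L N ks" "i \<in> {1..L-1}"
  shows "flip_outside i N S A \<in> set_tuples L N ks"
  unfolding flip_outside_def
  by (rule transpose_image_set_tuples[OF assms]) (auto simp: active_def)

lemma canonical_set_tuples:
  assumes "S \<in> set_tuples L N ks" "i \<in> {1..L-1}"
  shows "canonical i N S \<in> set_tuples L N ks"
proof -
  have "canonical i N S = (\<lambda>n. if n \<in> {n \<in> {1..N}. i \<notin> S n \<and> i + 1 \<in> S n}
      then transpose i (i + 1) ` S n else S n)"
    by (auto simp: canonical_def)
  then show ?thesis
    by (simp only:) (rule transpose_image_set_tuples[OF assms], blast)
qed

lemma transpose_image_mem:
  "i \<in> transpose i (i + 1) ` S \<longleftrightarrow> i + 1 \<in> S" "i + 1 \<in> transpose i (i + 1) ` S \<longleftrightarrow> i \<in> (S :: nat set)"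
  by (auto simp: transpose_def image_iff split: if_splits)

text \<open>\<open>A\<close> is recovered as the set of active positions where \<open>i\<close> is
  still present, and \<open>canonical\<close> undoes every flip.\<close>

lemma bij_betw_flip_outside:
  assumes "S\<^sub>0 \<in> set_tuples L N ks" "i \<in> {1..L-1}"
    and can: "\<And>n. n \<in> {1..N} \<Longrightarrow> i + 1 \<in> S\<^sub>0 n \<Longrightarrow> i \<in> S\<^sub>0 n"
  shows "bij_betw (flip_outside i N S\<^sub>0) (Pow (active i N S\<^sub>0))
    {S \<in> set_tuples L N ks. canonical i N S = S\<^sub>0}"
proof (rule bij_betw_byWitness[where f' = "\<lambda>S. {n \<in> active i N S\<^sub>0. i \<in> S n}"])
  show "\<forall>A\<in>Pow (active i N S\<^sub>0). {n \<in> active i N S\<^sub>0. i \<in> flip_outside i N S\<^sub>0 A n} = A"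
    by (auto simp: flip_outside_def active_def transpose_image_mem split: if_splits
        simp del: One_nat_def add_Suc_right Nat.add_0_right)
  show "flip_outside i N S\<^sub>0 ` Pow (active i N S\<^sub>0) \<subseteq> {S \<in> set_tuples L N ks. canonical i N S = S\<^sub>0}"
  proof clarify
    fix A
    have "canonical i N (flip_outside i N S\<^sub>0 A) n = S\<^sub>0 n" for n
      using can[of n]
      by (auto simp only: canonical_def flip_outside_def active_def transpose_image_mem
          image_image transpose_involutory image_ident split: if_splits)
    then show "flip_outside i N S\<^sub>0 A \<in> set_tuples L N ks \<and> canonical i N (flip_outside i N S\<^sub>0 A) = S\<^sub>0"
      using flip_outside_set_tuples assms by blast
  qed
  show "\<forall>S\<in>{S \<in> set_tuples L N ks. canonical i N S = S\<^sub>0}.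
      flip_outside i N S\<^sub>0 {n \<in> active i N S\<^sub>0. i \<in> S n} = S"
  proof clarify
    fix S
    show "flip_outside i N (canonical i N S) {n \<in> active i N (canonical i N S). i \<in> S n} = S"
    proof
      fix n
      show "flip_outside i N (canonical i N S) {n \<in> active i N (canonical i N S). i \<in> S n} n = S n"
        unfolding flip_outside_def active_def canonical_def
        by (auto simp: transpose_image_mem image_image simp del: One_nat_def add_Suc_right Nat.add_0_right)
    qed
  qed
qed auto

lemma yvar_Suc: "yvar L ks x n (j + 1) = yvar L ks x n j * omega_pow L (-1)"
proof -
  have "(of_nat (ks n) + 1 - 2 * of_nat (j + 1)) / 2
      = (of_nat (ks n) + 1 - 2 * of_nat j) / 2 + (-1 :: complex)"
    by (simp add: field_simps)
  then show ?thesis unfolding yvar_def by (simp only: omega_pow_add mult.assoc)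
qed

text \<open>Within a class, an active position contributes the weight of \<open>i\<close> if it lies
  in \<open>A\<close> and that of \<open>i + 1\<close> otherwise. A factor of \<open>Phi\<close>
  depends on \<open>A\<close> only between two active positions on different sides; its arguments
  \<open>u\<close> do not, since flipping preserves ranks. All else is a common prefactor.\<close>

lemma sum_flip_outside:
  assumes a: "a \<in> hstar L" and i: "i \<in> {1..L-1}"
    and S: "S \<in> set_tuples L N ks"
    and can: "\<And>n. n \<in> {1..N} \<Longrightarrow> i + 1 \<in> S n \<Longrightarrow> i \<in> S n"
    and nz: "\<And>n. n \<in> {1..N} \<Longrightarrow> x n \<noteq> 0"
  defines "u \<equiv> \<lambda>n. yvar L ks x n (rank (S n) i)"
  shows "(\<Sum>A\<in>Pow (active i N S).
      omega_pow L (form L a (\<lambda>j. \<Sum>n=1..N. set_weight L (flip_outside i N S A n) j))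
        * Phi L p N ks (flip_outside i N S A) x) =
    (\<Prod>n=1..N. omega_pow L (sum a (if n \<in> active i N S then S n - {i} else S n)))
    * (\<Prod>n\<in>{1..N}. \<Prod>m\<in>{1..<n}. block L p (S m) (S n) (yvar L ks x m) (yvar L ks x n))
    * split_sum (\<lambda>m n. f L p (u m / u n)) (active i N S)
        (\<lambda>_. omega_pow L (a i)) (\<lambda>_. omega_pow L (a (i + 1)))"
  unfolding split_sum_def sum_distrib_left
proof (rule sum.cong[OF refl])
  fix A assume A: "A \<in> Pow (active i N S)"
  define B where "B = active i N S"
  define fl where "fl = flip_outside i N S A"
  have fl_in: "fl n = (if n \<in> A then id else transpose i (i + 1)) ` S n" if "n \<in> B" for n
    using that by (simp add: fl_def flip_outside_def B_def)
  have fl_out: "fl n = S n" if "n \<notin> B" for n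
    using that by (simp add: fl_def flip_outside_def B_def)
  have AB: "A \<subseteq> B" "A \<subseteq> {1..N}" "B \<subseteq> {1..N}" using A by (auto simp: B_def active_def)
  have mem: "i \<in> S n" "i + 1 \<notin> S n" if "n \<in> B" for n using that by (auto simp: B_def active_def)
  have inact: "i \<in> S n \<longleftrightarrow> i + 1 \<in> S n" if "n \<in> {1..N}" "n \<notin> B" for n
    using that can by (auto simp: B_def active_def)
  have fin: "finite (S n)" if "n \<in> {1..N}" for n
    using S that finite_subset unfolding set_tuples_def by blast
  have fl_T: "fl \<in> set_tuples L N ks" unfolding fl_def by (rule flip_outside_set_tuples[OF S i])
  have restrict_prod: "(\<Prod>n=1..N. if n \<in> C then g n else 1) = prod g C" if "C \<subseteq> {1..N}" for C and g :: "nat \<Rightarrow> complex"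
    using that prod.inter_restrict[of "{1..N}" g C] by (simp add: Int_absorb1)

  define b where "b = (\<lambda>n. omega_pow L (sum a (if n \<in> B then S n - {i} else S n)))"
  have weight: "omega_pow L (sum a (fl n)) =
      b n * ((if n \<in> A then omega_pow L (a i) else 1) * (if n \<in> B - A then omega_pow L (a (i + 1)) else 1))"
    if n: "n \<in> {1..N}" for n
  proof (cases "n \<in> B")
    case True
    have *: "sum a (S n) = sum a (S n - {i}) + a i"
      using sum.remove[OF fin[OF n] mem(1)[OF True], of a] by (simp add: add.commute)
    have "sum a (transpose i (i + 1) ` S n) = (\<Sum>s\<in>S n. a (transpose i (i + 1) s))"
      by (simp add: sum.reindex inj_on_transpose)
    also have "\<dots> = a (i + 1) + (\<Sum>s\<in>S n - {i}. a (transpose i (i + 1) s))"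
      using sum.remove[OF fin[OF n] mem(1)[OF True], of "\<lambda>s. a (transpose i (i + 1) s)"] by simp
    also have "(\<Sum>s\<in>S n - {i}. a (transpose i (i + 1) s)) = sum a (S n - {i})"
      by (rule sum.cong) (use mem(2)[OF True] in \<open>auto simp: transpose_def\<close>)
    finally have "sum a (transpose i (i + 1) ` S n) = sum a (S n - {i}) + a (i + 1)"
      by simp
    with True * show ?thesis
      by (auto simp: fl_in b_def omega_pow_add)
  next
    case False
    then show ?thesis using AB by (auto simp: fl_out b_def)
  qed
  have weights: "omega_pow L (form L a (\<lambda>j. \<Sum>n=1..N. set_weight L (fl n) j))
      = prod b {1..N} * (prod (\<lambda>_. omega_pow L (a i)) A * prod (\<lambda>_. omega_pow L (a (i + 1))) (B - A))"
  proof -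
    have "B - A \<subseteq> {1..N}" using AB by auto
    then show ?thesis
      unfolding omega_pow_form_set_tuple[OF a fl_T]
      by (simp only: weight prod.distrib restrict_prod[OF AB(2)] restrict_prod cong: prod.cong)
  qed

  define k where "k = (\<lambda>m n. f L p (u m / u n))"
  \<comment> \<open>\<open>h m n\<close> is the factor created when \<open>m\<close> keeps
    \<open>i\<close> and \<open>n\<close> receives \<open>i + 1\<close>. At most one of
    \<open>h m n\<close> and \<open>h n m\<close> is nontrivial, so their product covers both
    orientations of a pair.\<close>
  define h where "h = (\<lambda>m n. if m \<in> A \<and> n \<in> B - A then k m n else 1)"
  let ?C = "\<lambda>m n. block L p (S m) (S n) (yvar L ks x m) (yvar L ks x n)"
  have Y_nz: "yvar L ks x n j \<noteq> 0" if "n \<in> {1..N}" for n j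
    using nz[OF that] by (simp add: yvar_def)
  have mixed: "block L p (fl m) (S n) (yvar L ks x m) (yvar L ks x n) = ?C m n"
    if "m \<in> {1..N}" "n \<in> {1..N}" "m \<in> B" "n \<notin> B" for m n
  proof -
    have "block L p (transpose i (i + 1) ` S m) (S n) (yvar L ks x m) (yvar L ks x n) = ?C m n"
      by (rule block_transpose_inactive[OF fin[OF that(2)] mem[OF that(3)] inact[OF that(2,4)]])
        (rule Y_nz[OF that(1)] Y_nz[OF that(2)] yvar_Suc)+
    then show ?thesis by (simp add: fl_in[OF that(3)])
  qed
  have blocks: "block L p (fl m) (fl n) (yvar L ks x m) (yvar L ks x n) = ?C m n * (h m n * h n m)"
    if m: "m \<in> {1..N}" and n: "n \<in> {1..N}" for m n
  proof (cases "m \<in> B"; cases "n \<in> B")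
    assume B: "m \<in> B" "n \<in> B"
    show ?thesis
      unfolding fl_in[OF B(1)] fl_in[OF B(2)]
      by (subst block_transpose_active[OF fin[OF m] fin[OF n] mem[OF B(1)] mem[OF B(2)]])
        (use B in \<open>auto simp: h_def k_def u_def pair_factor_def\<close>)
  next
    assume B: "m \<in> B" "n \<notin> B"
    then show ?thesis using mixed[OF m n B] AB by (auto simp: fl_out h_def)
  next
    assume B: "m \<notin> B" "n \<in> B"
    then show ?thesis
      using mixed[OF n m B(2,1)] AB
      by (subst (1 2) block_commute) (auto simp: fl_out h_def)
  next
    assume B: "m \<notin> B" "n \<notin> B"
    then show ?thesis using AB by (auto simp: fl_out h_def)
  qed
  have "Phi L p N ks fl x = (\<Prod>n\<in>{1..N}. \<Prod>m\<in>{1..<n}. ?C m n * (h m n * h n m))"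
    unfolding Phi_eq_prod_block[OF fl_T] by (intro prod.cong refl blocks) auto
  also have "\<dots> = (\<Prod>n\<in>{1..N}. \<Prod>m\<in>{1..<n}. ?C m n) * (\<Prod>m\<in>{1..N}. \<Prod>n\<in>{1..N}. h m n)"
  proof -
    have "h n n = 1" for n by (auto simp: h_def)
    from prod_triangle[of h, OF this] show ?thesis by (simp only: prod.distrib)
  qed
  also have "(\<Prod>m\<in>{1..N}. \<Prod>n\<in>{1..N}. h m n) = (\<Prod>m=1..N. if m \<in> A then \<Prod>n\<in>B - A. k m n else 1)"
  proof (rule prod.cong[OF refl])
    fix m
    have "B - A \<subseteq> {1..N}" using AB by auto
    then show "(\<Prod>n\<in>{1..N}. h m n) = (if m \<in> A then \<Prod>n\<in>B - A. k m n else 1)"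
      using restrict_prod[of "B - A" "k m"] by (simp add: h_def)
  qed
  also have "\<dots> = (\<Prod>m\<in>A. \<Prod>n\<in>B - A. k m n)"
    by (rule restrict_prod[OF AB(2)])
  finally have "Phi L p N ks fl x =
      (\<Prod>n\<in>{1..N}. \<Prod>m\<in>{1..<n}. ?C m n) * (\<Prod>m\<in>A. \<Prod>n\<in>B - A. k m n)" .
  with weights show "omega_pow L (form L a (\<lambda>j. \<Sum>n=1..N. set_weight L (flip_outside i N S A n) j))
        * Phi L p N ks (flip_outside i N S A) x =
    (\<Prod>n=1..N. omega_pow L (sum a (if n \<in> active i N S then S n - {i} else S n)))
    * (\<Prod>n\<in>{1..N}. \<Prod>m\<in>{1..<n}. ?C m n)
    * (prod (\<lambda>_. omega_pow L (a i)) A * prod (\<lambda>_. omega_pow L (a (i + 1))) (active i N S - A)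
        * (\<Prod>m\<in>A. \<Prod>n\<in>active i N S - A. f L p (u m / u n)))"
    unfolding fl_def b_def B_def k_def by (simp add: mult_ac)
qed

text \<open>Regularity speaks only of ratios that occur in some summand. Flipping every active set
  except that of \<open>m\<close> yields a tuple with \<open>i\<close> at \<open>m\<close> and
  \<open>i + 1\<close> at \<open>n\<close>, in which this ratio occurs.\<close>

lemma active_ratio_not_pole:
  assumes reg: "J_regular L N x ks" and i: "i \<in> {1..L-1}" and S: "S \<in> set_tuples L N ks"
    and mn: "m \<in> active i N S" "n \<in> active i N S" "m \<noteq> n"
  shows "yvar L ks x m (rank (S m) i) / yvar L ks x n (rank (S n) i) \<notin> f_poles L"
proof -
  define S' where "S' = flip_outside i N S {m}"
  have S': "S' \<in> set_tuples L N ks" unfolding S'_def by (rule flip_outside_set_tuples[OF S i])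
  have N: "m \<in> {1..N}" "n \<in> {1..N}" and mem: "i \<in> S m" "i \<in> S n" "i + 1 \<notin> S n"
    using mn by (auto simp: active_def)
  have fin: "finite (T j)" "card (T j) = ks j" if "T \<in> set_tuples L N ks" "j \<in> {1..N}" for T j
    using that finite_subset unfolding set_tuples_def by blast+
  have S'm: "S' m = S m" and S'n: "S' n = transpose i (i + 1) ` S n"
    using mn by (auto simp: S'_def flip_outside_def)
  have rank_n: "rank (S' n) (i + 1) = rank (S n) i"
    unfolding S'n using rank_transpose[OF mem(3,2)] by simp
  have "i + 1 \<in> S' n" unfolding S'n using mem by (simp only: transpose_image_mem)
  note n = elt_rank[OF fin(1)[OF S' N(2)] this, unfolded rank_n fin(2)[OF S' N(2)]]
  have "i \<in> S' m" unfolding S'm using mem by simp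
  note m = elt_rank[OF fin(1)[OF S' N(1)] this, unfolded S'm fin(2)[OF S N(1)]]
  show ?thesis
  proof (cases "m < n")
    case True
    then have "m \<in> {1..<n}" using N by auto
    with reg S' N(2) m(1) n(1) show ?thesis
      unfolding J_regular_def using m(2) n(2) S'm by (metis less_add_one)
  next
    case False
    then have "n \<in> {1..<m}" using N mn(3) by auto
    with reg S' N(1) m(1) n(1) show ?thesis
      unfolding J_regular_def using m(2) n(2) S'm by (metis less_add_one)
  qed
qed

section \<open>Invariance under simple reflections\<close>

lemma finite_set_tuples: "finite (set_tuples L N ks)"
  unfolding set_tuples_def by (intro finite_PiE) (auto intro: finite_subset[of _ "Pow {1..L}"])

text \<open>Groups the tuples by the fibres of \<open>canonical\<close>. The grouping does not
  involve \<open>a\<close>, so the sums for \<open>a\<close> and for its reflection can be compared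
  class by class.\<close>

lemma J_eq_sum_canonical:
  assumes i: "i \<in> {1..L-1}"
  shows "J L p N a x ks = (\<Sum>S\<in>canonical i N ` set_tuples L N ks. \<Sum>A\<in>Pow (active i N S).
      omega_pow L (form L a (\<lambda>j. \<Sum>n=1..N. set_weight L (flip_outside i N S A n) j))
        * Phi L p N ks (flip_outside i N S A) x)"
proof -
  let ?T = "set_tuples L N ks"
  let ?g = "\<lambda>S. omega_pow L (form L a (\<lambda>i. \<Sum>n=1..N. set_weight L (S n) i)) * Phi L p N ks S x"
  have "J L p N a x ks = (\<Sum>S\<in>canonical i N ` ?T. sum ?g {S' \<in> ?T. canonical i N S' = S})"
    unfolding J_def by (rule sum.group[symmetric]) (auto simp: finite_set_tuples)
  also have "\<dots> = (\<Sum>S\<in>canonical i N ` ?T. \<Sum>A\<in>Pow (active i N S). ?g (flip_outside i N S A))"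
  proof (rule sum.cong[OF refl])
    fix S assume "S \<in> canonical i N ` ?T"
    then have S: "S \<in> ?T" "\<And>n. n \<in> {1..N} \<Longrightarrow> i + 1 \<in> S n \<Longrightarrow> i \<in> S n"
      using canonical_set_tuples[OF _ i]
      by (auto simp: canonical_def transpose_image_mem
          simp del: One_nat_def add_Suc_right Nat.add_0_right split: if_splits)
    show "sum ?g {S' \<in> ?T. canonical i N S' = S} = (\<Sum>A\<in>Pow (active i N S). ?g (flip_outside i N S A))"
      by (rule sum.reindex_bij_betw[OF bij_betw_flip_outside[OF S(1) i S(2)], symmetric])
  qed
  finally show ?thesis .
qed

text \<open>On each class the reflection fixes the prefactor and swaps the two constant weights of
  the splitting sum, which is symmetric in them.\<close>

lemma J_simple_reflection:
  assumes a: "a \<in> hstar L" and i: "i \<in> {1..L-1}" and reg: "J_regular L N x ks"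
  shows "J L p N (simple_reflection L i a) x ks = J L p N a x ks"
  unfolding J_eq_sum_canonical[OF i]
proof (rule sum.cong[OF refl])
  fix S assume "S \<in> canonical i N ` set_tuples L N ks"
  then have S: "S \<in> set_tuples L N ks" "\<And>n. n \<in> {1..N} \<Longrightarrow> i + 1 \<in> S n \<Longrightarrow> i \<in> S n"
    using canonical_set_tuples[OF _ i]
    by (auto simp: canonical_def transpose_image_mem
        simp del: One_nat_def add_Suc_right Nat.add_0_right split: if_splits)
  let ?a = "simple_reflection L i a" and ?B = "active i N S"
  define u where "u = (\<lambda>n. yvar L ks x n (rank (S n) i))"
  let ?k = "\<lambda>m n. f L p (u m / u n)"
  have nz: "x n \<noteq> 0" if "n \<in> {1..N}" for n
    using reg that by (simp add: J_regular_def)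
  have u_nz: "u n \<noteq> 0" if "n \<in> ?B" for n
    using nz[of n] that by (simp add: u_def yvar_def active_def)
  have sa: "?a i = a (i + 1)" "?a (i + 1) = a i"
    by (simp_all only: simple_reflection_eq_transpose[OF i] o_apply transpose_apply_first transpose_apply_second)
  \<comment> \<open>With \<open>i\<close> removed from the active sets, each set contains both or
    neither of \<open>i\<close> and \<open>i + 1\<close>, hence is stable under their
    exchange.\<close>
  have fixed: "sum ?a (if n \<in> ?B then S n - {i} else S n) = sum a (if n \<in> ?B then S n - {i} else S n)"
    if n: "n \<in> {1..N}" for n
  proof -
    let ?R = "if n \<in> ?B then S n - {i} else S n"
    have "i \<in> ?R \<longleftrightarrow> i + 1 \<in> ?R"
      using S(2)[OF n] n by (auto simp: active_def)
    then have "transpose i (i + 1) ` ?R = ?R" by (rule transpose_image_eq)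
    moreover have "sum (a \<circ> transpose i (i + 1)) ?R = sum a (transpose i (i + 1) ` ?R)"
      by (rule sum.reindex[OF inj_on_transpose, symmetric])
    ultimately show ?thesis
      by (simp only: simple_reflection_eq_transpose[OF i])
  qed
  have eq_kern: "split_sum ?k ?B (\<lambda>_. s) (\<lambda>_. t) =
      split_sum (\<lambda>m n. kern (omega_pow L 1) (omega_pow L (of_real p)) (u m) (u n)) ?B (\<lambda>_. s) (\<lambda>_. t)"
    for s t
    by (rule split_sum_cong) (use u_nz f_divide_eq_kern in auto)
  have sym: "split_sum ?k ?B (\<lambda>_. s) (\<lambda>_. t) = split_sum ?k ?B (\<lambda>_. t) (\<lambda>_. s)" for s t
    unfolding eq_kern
  proof (rule split_sum_kern_symmetric)
    \<comment> \<open>The two excluded coincidences say that \<open>u m / u n\<close> is a pole of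
      \<open>f\<close>.\<close>
    fix m n assume mn: "m \<in> ?B" "n \<in> ?B" "m \<noteq> n"
    show "u m \<noteq> u n \<and> u m \<noteq> omega_pow L 1 * u n"
      using active_ratio_not_pole[OF reg i S(1) mn] u_nz[OF mn(2)]
      by (auto simp: f_poles_def u_def)
  qed (use u_nz in \<open>auto simp: active_def\<close>)
  have eq: "(\<Sum>A\<in>Pow ?B. omega_pow L (form L b (\<lambda>j. \<Sum>n=1..N. set_weight L (flip_outside i N S A n) j))
        * Phi L p N ks (flip_outside i N S A) x) =
      (\<Prod>n=1..N. omega_pow L (sum b (if n \<in> ?B then S n - {i} else S n)))
      * (\<Prod>n\<in>{1..N}. \<Prod>m\<in>{1..<n}. block L p (S m) (S n) (yvar L ks x m) (yvar L ks x n))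
      * split_sum ?k ?B (\<lambda>_. omega_pow L (b i)) (\<lambda>_. omega_pow L (b (i + 1)))"
    if "b \<in> hstar L" for b
    unfolding u_def by (rule sum_flip_outside[OF that i S(1)]) (use S(2) nz in auto)
  show "(\<Sum>A\<in>Pow ?B. omega_pow L (form L ?a (\<lambda>j. \<Sum>n=1..N. set_weight L (flip_outside i N S A n) j))
        * Phi L p N ks (flip_outside i N S A) x) =
      (\<Sum>A\<in>Pow ?B. omega_pow L (form L a (\<lambda>j. \<Sum>n=1..N. set_weight L (flip_outside i N S A n) j))
        * Phi L p N ks (flip_outside i N S A) x)"
    unfolding eq[OF a] eq[OF simple_reflection_in_hstar[OF i a]] sa
    by (subst sym) (simp add: fixed)
qed

section \<open>From simple reflections to the Weyl group\<close>

lemma J_weyl_group: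
  assumes "w \<in> weyl_group L" "a \<in> hstar L" and reg: "J_regular L N x ks"
  shows "w a \<in> hstar L \<and> J L p N (w a) x ks = J L p N a x ks"
  using assms(1,2) unfolding weyl_group_def
\<comment> \<open>Membership in \<open>hstar L\<close> is carried along because for a product the
  claim for the left factor is applied to the image of \<open>a\<close> under the right one.\<close>
proof (induction arbitrary: a rule: generate.induct)
  case one
  then show ?case by (simp add: BijGroup_def)
next
  case (incl h)
  then show ?case
    using simple_reflection_in_hstar J_simple_reflection[OF _ _ reg] by auto
next
  case (inv h)
  then obtain i where i: "i \<in> {1..L-1}" "h = restrict (simple_reflection L i) (hstar L)" by auto
  interpret group "BijGroup (hstar L)" by (rule group_BijGroup)
  have h: "h \<in> carrier (BijGroup (hstar L))"
    unfolding i(2) by (rule simple_reflection_in_BijGroup[OF i(1)])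
  \<comment> \<open>A generator is its own inverse, so inverses of generators act as simple
    reflections too.\<close>
  have "h \<otimes>\<^bsub>BijGroup (hstar L)\<^esub> h = \<one>\<^bsub>BijGroup (hstar L)\<^esub>"
    using h i simple_reflection_in_hstar[OF i(1)] simple_reflection_involution[OF i(1)]
    by (auto simp: BijGroup_def compose_def)
  then have "inv\<^bsub>BijGroup (hstar L)\<^esub> h = h"
    using h inv_equality by blast
  then show ?case
    using i inv.prems simple_reflection_in_hstar J_simple_reflection[OF _ _ reg] by auto
next
  case (eng h1 h2)
  let ?gens = "(\<lambda>i. restrict (simple_reflection L i) (hstar L)) ` {1..L-1}"
  interpret group "BijGroup (hstar L)" by (rule group_BijGroup)
  have "?gens \<subseteq> carrier (BijGroup (hstar L))"
    using simple_reflection_in_BijGroup by auto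
  then have "h1 \<in> carrier (BijGroup (hstar L))" "h2 \<in> carrier (BijGroup (hstar L))"
    using eng.hyps generate_in_carrier by blast+
  then have "(h1 \<otimes>\<^bsub>BijGroup (hstar L)\<^esub> h2) a = h1 (h2 a)"
    using eng.prems by (simp add: BijGroup_def compose_def)
  then show ?case using eng by simp
qed

theorem theorem3:
  fixes L :: nat and p :: real
  assumes "L \<ge> 2" and "0 < p" and "p < 1" and "p \<notin> \<rat>"
  shows
    "(\<forall>a\<in>hstar L. \<forall>w\<in>weyl_group L. \<forall>k\<in>{1..L}. \<forall>N\<ge>1. \<forall>z X.
        Jz_regular L p k N z X \<longrightarrow> Jz L p k N a z X = Jz L p k N (w a) z X) \<and>
     (\<forall>a\<in>hstar L. \<forall>w\<in>weyl_group L. \<forall>N ks x.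
        (\<forall>n\<in>{1..N}. ks n \<in> {1..L-1}) \<longrightarrow> J_regular L N x ks \<longrightarrow>
        J L p N a x ks = J L p N (w a) x ks)"
  \<comment> \<open>The prefactor in \<open>Jz\<close> does not depend on \<open>a\<close>, and
    \<open>Jz_regular\<close> includes regularity of the function \<open>J\<close> inside
    it.\<close>
  using J_weyl_group unfolding Jz_def Jz_regular_def by auto

end
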